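(* Let $\mathbb{F}$ be a field, let $R=\mathbb{F}[x_0,\dots,x_{n-1}]$ with a fixed monomial ordering, and let $f_0,\dots,f_{m-1}\in R$ be nonzero homogeneous polynomials. If the algorithm $F_{4/5}$ (described in full in the context) terminates on the input $\{f_0,\dots,f_{m-1}\}$ and returns $g_0,\dots,g_{r-1}$, where $g_0,\dots,g_{r-1}$ are homogeneous polynomials in $R$, then $g_0,\dots,g_{r-1}$ is a Gröbner basis, with respect to the given monomial ordering, of the ideal of $R$ generated by $f_0,\dots,f_{m-1}$.
   Context: Notation. $\mathrm{LM}(f)$ and $\mathrm{LC}(f)$ are the leading monomial and leading coefficient of a nonzero polynomial $f$; $\mathrm{LCM}$ is the least common multiple of monomials. A signature is $t\mathbf{e}_i$ with $t$ a monomial of $R$ and $\mathbf{e}_i$ ($0\le i<m$) the $i$-th canonical unit vector of $R^m$. Signatures are ordered by: $t\mathbf{e}_i>u\mathbf{e}_j$ iff $i>j$, or $i=j$ and $t>u$. For a monomial $u$, $u\cdot(t\mathbf{e}_i)=(ut)\mathbf{e}_i$. A labelled polynomial is a pair $(\sigma,p)$ with $\sigma$ a signature and $p\in R$. The algorithm maintains a global list $L=(L_0,L_1,\dots)$ of labelled polynomials, and elements of $L$ are referred to by their position. If $L_k=(t\mathbf{e}_i,p)$, write $\mathrm{poly}(k)=p$, $\mathrm{sig}(k)=t\mathbf{e}_i$, $\mathrm{idx}(k)=i$. It also maintains global lists $Rules_0,\dots,Rules_{m-1}$, initially empty, whose entries are pairs $(t,k)$ with $t$ a monomial and $k$ a position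 in $L$. AddRule$(t\mathbf{e}_i,k)$: insert $(t,k)$ into $Rules_i$ so that $Rules_i$ stays sorted in increasing order of the monomial component; the new entry is placed after existing entries with the same monomial. Rewritable$(u,k)$: let $\mathrm{sig}(k)=t\mathbf{e}_i$. Go through $Rules_i$ from the last entry to the first; at the first entry $(v,j)$ met with $v\mid ut$, return the truth value of $j\ne k$. If there is no such entry, return false. TopReducible$(t,H)$, for a monomial $t$ and a set $H$ of positions in $L$: true iff $\mathrm{LM}(\mathrm{poly}(g))\mid t$ for some $g\in H$. Update$(k,l,G)$: let $t_k=\mathrm{LM}(\mathrm{poly}(k))$, $t_l=\mathrm{LM}(\mathrm{poly}(l))$, $t=\mathrm{LCM}(t_k,t_l)$, $u_k=t/t_k$, $u_l=t/t_l$, $\mathrm{sig}(k)=m_k\mathbf{e}_{\mathrm{idx}(k)}$, $\mathrm{sig}(l)=m_l\mathbf{e}_{\mathrm{idx}(l)}$. Return nothing if any of the following holds: TopReducible$(u_km_k,\{g\in G:\mathrm{idx}(g)<\mathrm{idx}(k)\})$; TopReducible$(u_lm_l,\{g\in G:\mathrm{idx}(g)<\mathrm{idx}(l)\})$; Rewritable$(u_k,k)$; Rewritable$(u_l,l)$. Otherwise, if $u_k\,\mathrm{sig}(k)<u_l\,\mathrm{sig}(l)$, swap $u_k$ with $u_l$ and $k$ with $l$. Return the critical pair $(t,u_k,k,u_l,l)$, whose degree is $\deg t$. SPolynomials$(P_d)$: return the set $S$ of all $(u,k)$ arising from pairs $(t,u,k,v,l)\in P_d$ for which neither Rewritable$(u,k)$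 nor Rewritable$(v,l)$ holds. FindReductor$(\mu,G,F)$, for a monomial $\mu$: for $k\in G$ in turn, skip $k$ if $\mathrm{LM}(\mathrm{poly}(k))\nmid \mu$; otherwise put $u=\mu/\mathrm{LM}(\mathrm{poly}(k))$ and $\mathrm{sig}(k)=t\mathbf{e}_i$, and skip $k$ if $(u,k)\in F$, or TopReducible$(ut,\{g\in G:\mathrm{idx}(g)<i\})$, or Rewritable$(u,k)$. Return $(u,k)$ for the first $k$ not skipped; if there is none, return "no reductor". SymbolicPreprocessing$(S,G)$: set $F=S$, $Done=\varnothing$, and let $M'$ be the set of monomials occurring in the products $u\cdot\mathrm{poly}(k)$, $(u,k)\in F$. While $M'\neq Done$: let $\mu$ be the maximal element of $M'\setminus Done$, add $\mu$ to $Done$, call FindReductor$(\mu,G,F)$, and if it returns $(t,k)$, append $(t,k)$ to $F$ and add the monomials of $t\cdot\mathrm{poly}(k)$ to $M'$. Finally, sort $F$ by the signatures $u\cdot\mathrm{sig}(k)$ of its elements $(u,k)$, in increasing order, and return $F$ together with $T$, the list of elements of $Done$ in decreasing monomial order. GaussianElimination$(F,T)$: write $F=(F_0,\dots,F_{M-1})$ with $F_i=(u_i,k_i)$, and $T=(T_0,\dots,T_{N-1})$. Let $A=(a_{ij})$ be the $M\times N$ matrix where $a_{ij}$ is the coefficient of $T_j$ in $u_i\cdot\mathrm{poly}(k_i)$. For $c=0,\dots,N-1$: find the smallest $r$ such that $a_{rc}\ne0$ and $a_{rj}=0$ for all $j<c$; if it exists, rescale row $r$ so that $a_{rc}=1$,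 and for every $i>r$ with $a_{ic}\neq0$ subtract $a_{ic}$ times row $r$ from row $i$. Rows and columns are never swapped. Return $\tilde F=(\tilde F_0,\dots,\tilde F_{M-1})$ with $\tilde F_i=\sum_j a_{ij}T_j$. Reduction$(S,G)$: let $(F,T)=$ SymbolicPreprocessing$(S,G)$, $\tilde F=$ GaussianElimination$(F,T)$, $\tilde F^+=\varnothing$. For $k=0,\dots,|F|-1$: let $(u,i)=F_k$. If $\tilde F_k\ne 0$ and $\mathrm{LM}(\tilde F_k)=u\cdot\mathrm{LM}(\mathrm{poly}(i))$, do nothing. Otherwise append $(u\cdot\mathrm{sig}(i),\tilde F_k)$ to $L$, call AddRule$(u\cdot\mathrm{sig}(i),|L|-1)$, and, if $\tilde F_k\neq0$, add the new position $|L|-1$ to $\tilde F^+$. Return $\tilde F^+$. Main algorithm $F_{4/5}$: sort the input by total degree (increasing), calling the sorted list $f_0,\dots,f_{m-1}$. Set $L$ to the empty list and $G=P=\varnothing$. For $i=0,\dots,m-1$: append $(1\cdot\mathbf{e}_i,\mathrm{LC}(f_i)^{-1}f_i)$ to $L$, call AddRule$(1\cdot\mathbf{e}_i,i)$, add to $P$ all critical pairs returned by Update$(i,j,G)$ for $j\in G$, then add $i$ to $G$. While $P\ne\varnothing$: let $d$ be the minimal degree of a pair in $P$, let $P_d$ be the set of all pairs of degree $d$ in $P$, and remove $P_d$ from $P$; let $S=$ SPolynomials$(P_d)$ and $\tilde S=$ Reduction$(S,G)$; for each $i\in\tilde S$, add to $P$ all critical pairs returned by Update$(i,j,G)$ for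 $j\in G$, then add $i$ to $G$. When $P=\varnothing$, return $\{\mathrm{poly}(g): g\in G\}$. *)

theory Defs
  imports Complex_Main "HOL-Library.Poly_Mapping" "HOL-Library.Multiset"
begin

section \<open>Monomials and polynomials\<close>

text \<open>
  The variables are the elements of a finite type \<open>'x\<close>, so \<open>n\<close> is \<open>card (UNIV :: 'x set)\<close>.
  A monomial is its exponent vector: the product of monomials is \<open>+\<close>, the monomial 1 is \<open>0\<close>, and
  the quotient \<open>t / s\<close> (for \<open>s\<close> dividing \<open>t\<close>) is \<open>t - s\<close>.  A polynomial is the finitely supported
  map of its coefficients, with the convolution product of \<^theory>\<open>HOL-Library.Poly_Mapping\<close>.
\<close>

type_synonym 'x monomial = "'x \<Rightarrow>\<^sub>0 nat"
type_synonym ('x, 'a) mpoly = "'x monomial \<Rightarrow>\<^sub>0 'a"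

definition mdvd :: "'x monomial \<Rightarrow> 'x monomial \<Rightarrow> bool"
  where "mdvd s t \<longleftrightarrow> (\<exists>u. t = s + u)"

lift_definition mlcm :: "'x monomial \<Rightarrow> 'x monomial \<Rightarrow> 'x monomial"
  is "\<lambda>s t x. max (s x) (t x)"
proof -
  fix s t :: "'x \<Rightarrow> nat"
  assume "finite {x. s x \<noteq> 0}" "finite {x. t x \<noteq> 0}"
  moreover have "{x. max (s x) (t x) \<noteq> 0} \<subseteq> {x. s x \<noteq> 0} \<union> {x. t x \<noteq> 0}"
    by (auto simp: max_def)
  ultimately show "finite {x. max (s x) (t x) \<noteq> 0}"
    by (meson finite_UnI finite_subset)
qed

definition mdeg :: "'x::finite monomial \<Rightarrow> nat"
  where "mdeg t = (\<Sum>x\<in>UNIV. Poly_Mapping.lookup t x)"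

definition total_degree :: "('x::finite, 'a::zero) mpoly \<Rightarrow> nat"
  where "total_degree p = (if p = 0 then 0 else Max (mdeg ` Poly_Mapping.keys p))"

definition homogeneous :: "('x::finite, 'a::zero) mpoly \<Rightarrow> bool"
  where "homogeneous p \<longleftrightarrow> (\<exists>d. \<forall>t\<in>Poly_Mapping.keys p. mdeg t = d)"

definition mmult :: "'x monomial \<Rightarrow> ('x, 'a::comm_ring_1) mpoly \<Rightarrow> ('x, 'a) mpoly"
  where "mmult u p = Poly_Mapping.single u 1 * p"

text \<open>The ideal generated by \<open>B\<close>: a commutative ring is a module over itself, and the ideals are
  its submodules.\<close>

definition ideal_gen :: "'r::comm_ring_1 set \<Rightarrow> 'r set"
  where "ideal_gen B = module.span (*) B"

lemma module_times: "module ((*) :: 'r::comm_ring_1 \<Rightarrow> 'r \<Rightarrow> 'r)"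
  by unfold_locales (simp_all add: algebra_simps)


section \<open>Signatures, labelled polynomials, rules\<close>

text \<open>The signature \<open>t e\<^sub>i\<close> is the pair \<open>(t, i)\<close>.\<close>

type_synonym 'x signature = "'x monomial \<times> nat"

definition sig_mult :: "'x monomial \<Rightarrow> 'x signature \<Rightarrow> 'x signature"
  where "sig_mult u \<sigma> = (u + fst \<sigma>, snd \<sigma>)"

text \<open>The global data of the algorithm: the list \<open>L\<close> and the lists \<open>Rules\<^sub>i\<close>.\<close>

record (overloaded) ('x, 'a) f45_state =
  labelled :: "('x signature \<times> ('x, 'a) mpoly) list"
  rules :: "nat \<Rightarrow> ('x monomial \<times> nat) list"

definition sig_at :: "('x, 'a::zero) f45_state \<Rightarrow> nat \<Rightarrow> 'x signature"
  where "sig_at st k = fst (labelled st ! k)"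

definition poly_at :: "('x, 'a::zero) f45_state \<Rightarrow> nat \<Rightarrow> ('x, 'a) mpoly"
  where "poly_at st k = snd (labelled st ! k)"

definition idx_at :: "('x, 'a::zero) f45_state \<Rightarrow> nat \<Rightarrow> nat"
  where "idx_at st k = snd (sig_at st k)"

text \<open>The critical pair \<open>(t, u, k, v, l)\<close>.\<close>

type_synonym 'x critpair = "'x monomial \<times> 'x monomial \<times> nat \<times> 'x monomial \<times> nat"

definition pair_deg :: "'x::finite critpair \<Rightarrow> nat"
  where "pair_deg p = mdeg (fst p)"

definition rewritable :: "('x, 'a::zero) f45_state \<Rightarrow> 'x monomial \<Rightarrow> nat \<Rightarrow> bool"
  where "rewritable st u k = (case sig_at st k of (t, i) \<Rightarrow>
    (case find (\<lambda>(v, j). mdvd v (u + t)) (rev (rules st i)) of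
       None \<Rightarrow> False
     | Some (v, j) \<Rightarrow> j \<noteq> k))"

definition spolynomials ::
  "('x, 'a::zero) f45_state \<Rightarrow> 'x critpair set \<Rightarrow> ('x monomial \<times> nat) set"
  where "spolynomials st Pd =
    {(u, k) | t u k v l. (t, u, k, v, l) \<in> Pd \<and> \<not> rewritable st u k \<and> \<not> rewritable st v l}"


section \<open>Gaussian elimination without row or column swaps\<close>

text \<open>\<open>eliminate_column M c A\<close> treats column \<open>c\<close> of the matrix \<open>A\<close> with rows \<open>0, \<dots>, M - 1\<close>.\<close>

definition eliminate_column ::
  "nat \<Rightarrow> nat \<Rightarrow> (nat \<Rightarrow> nat \<Rightarrow> 'a::field) \<Rightarrow> (nat \<Rightarrow> nat \<Rightarrow> 'a)"
  where "eliminate_column M c A =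
    (let pivot = (\<lambda>r. r < M \<and> A r c \<noteq> 0 \<and> (\<forall>j<c. A r j = 0)) in
     if \<exists>r. pivot r then
       (let r = (LEAST r. pivot r);
            B = A(r := (\<lambda>j. A r j / A r c))
        in (\<lambda>i. if r < i \<and> i < M \<and> B i c \<noteq> 0 then (\<lambda>j. B i j - B i c * B r j) else B i))
     else A)"

definition gaussian_elimination ::
  "('x, 'a::field) f45_state \<Rightarrow> ('x monomial \<times> nat) list \<Rightarrow> 'x monomial list \<Rightarrow> ('x, 'a) mpoly list"
  where "gaussian_elimination st F T =
    (let M = length F; N = length T;
         A = (\<lambda>i j. Poly_Mapping.lookup (mmult (fst (F ! i)) (poly_at st (snd (F ! i)))) (T ! j));
         A' = fold (eliminate_column M) [0..<N] A
     in map (\<lambda>i. \<Sum>j<N. Poly_Mapping.single (T ! j) (A' i j)) [0..<M])"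


section \<open>Notions depending on the monomial ordering\<close>

locale monomial_ordering = mo: linorder le lt
  for le :: "'x::finite monomial \<Rightarrow> 'x monomial \<Rightarrow> bool"  (infix \<open>\<preceq>\<close> 50)
  and lt :: "'x monomial \<Rightarrow> 'x monomial \<Rightarrow> bool"  (infix \<open>\<prec>\<close> 50) +
  assumes one_least: "0 \<preceq> t"
    and mult_mono: "s \<preceq> t \<Longrightarrow> u + s \<preceq> u + t"
begin

text \<open>\<open>LM p\<close> is meaningful only for \<open>p \<noteq> 0\<close>.\<close>

definition LM :: "('x, 'a::zero) mpoly \<Rightarrow> 'x monomial"
  where "LM p = mo.Max (Poly_Mapping.keys p)"

definition LC :: "('x, 'a::zero) mpoly \<Rightarrow> 'a"
  where "LC p = Poly_Mapping.lookup p (LM p)"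

definition groebner_basis :: "('x, 'a::field) mpoly set \<Rightarrow> ('x, 'a) mpoly set \<Rightarrow> bool"
  where "groebner_basis B I \<longleftrightarrow>
    finite B \<and> B \<subseteq> I \<and>
    ideal_gen {Poly_Mapping.single (LM g) (1::'a) | g. g \<in> B \<and> g \<noteq> 0} =
    ideal_gen {Poly_Mapping.single (LM f) (1::'a) | f. f \<in> I \<and> f \<noteq> 0}"

definition sig_less :: "'x signature \<Rightarrow> 'x signature \<Rightarrow> bool"
  where "sig_less \<sigma> \<tau> \<longleftrightarrow> snd \<sigma> < snd \<tau> \<or> (snd \<sigma> = snd \<tau> \<and> fst \<sigma> \<prec> fst \<tau>)"

definition sig_le :: "'x signature \<Rightarrow> 'x signature \<Rightarrow> bool"
  where "sig_le \<sigma> \<tau> \<longleftrightarrow> sig_less \<sigma> \<tau> \<or> \<sigma> = \<tau>"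


subsection \<open>Subroutines\<close>

definition add_rule :: "'x signature \<Rightarrow> nat \<Rightarrow> ('x, 'a::zero) f45_state \<Rightarrow> ('x, 'a) f45_state"
  where "add_rule \<sigma> k st = (case \<sigma> of (t, i) \<Rightarrow>
    st\<lparr>rules := (rules st)(i :=
         takeWhile (\<lambda>(s, j). s \<preceq> t) (rules st i) @ [(t, k)] @
         dropWhile (\<lambda>(s, j). s \<preceq> t) (rules st i))\<rparr>)"

text \<open>Append \<open>(\<sigma>, p)\<close> to \<open>L\<close>, then call AddRule with \<open>\<sigma>\<close> and the new position.\<close>

definition append_labelled ::
  "'x signature \<Rightarrow> ('x, 'a::zero) mpoly \<Rightarrow> ('x, 'a) f45_state \<Rightarrow> ('x, 'a) f45_state"
  where "append_labelled \<sigma> p st =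
    (let st' = st\<lparr>labelled := labelled st @ [(\<sigma>, p)]\<rparr>
     in add_rule \<sigma> (length (labelled st') - 1) st')"

definition top_reducible :: "('x, 'a::zero) f45_state \<Rightarrow> 'x monomial \<Rightarrow> nat set \<Rightarrow> bool"
  where "top_reducible st t H \<longleftrightarrow> (\<exists>g\<in>H. mdvd (LM (poly_at st g)) t)"

definition update :: "('x, 'a::zero) f45_state \<Rightarrow> nat set \<Rightarrow> nat \<Rightarrow> nat \<Rightarrow> 'x critpair option"
  where "update st G k l =
    (let tk = LM (poly_at st k); tl = LM (poly_at st l); t = mlcm tk tl;
         uk = t - tk; ul = t - tl; mk = fst (sig_at st k); ml = fst (sig_at st l)
     in if top_reducible st (uk + mk) {g \<in> G. idx_at st g < idx_at st k}
         \<or> top_reducible st (ul + ml) {g \<in> G. idx_at st g < idx_at st l}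
         \<or> rewritable st uk k \<or> rewritable st ul l
        then None
        else if sig_less (sig_mult uk (sig_at st k)) (sig_mult ul (sig_at st l))
        then Some (t, ul, l, uk, k)
        else Some (t, uk, k, ul, l))"

text \<open>
  The paper iterates over sets (of positions) without fixing an order.  Below, every such iteration
  runs over an arbitrary duplicate-free list enumerating the set, and a sorted list is an arbitrary
  sorted permutation; so the algorithm is a relation between inputs and possible outputs.
  In \<open>find_reductor st \<mu> ks F\<close>, the list \<open>ks\<close> enumerates \<open>G\<close>.
\<close>

definition find_reductor ::
  "('x, 'a::zero) f45_state \<Rightarrow> 'x monomial \<Rightarrow> nat list \<Rightarrow> ('x monomial \<times> nat) list
    \<Rightarrow> ('x monomial \<times> nat) option"
  where "find_reductor st \<mu> ks F =
    map_option (\<lambda>k. (\<mu> - LM (poly_at st k), k))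
      (find (\<lambda>k. mdvd (LM (poly_at st k)) \<mu> \<and>
                 (let u = \<mu> - LM (poly_at st k); t = fst (sig_at st k); i = idx_at st k
                  in (u, k) \<notin> set F \<and>
                     \<not> top_reducible st (u + t) {g \<in> set ks. idx_at st g < i} \<and>
                     \<not> rewritable st u k))
        ks)"

text \<open>\<open>symbolic_loop st G F Done M F' Done'\<close>: the while-loop of SymbolicPreprocessing, started with
  the values \<open>F\<close>, \<open>Done\<close>, \<open>M\<close> of its variables, ends with \<open>F'\<close> and \<open>Done'\<close>.\<close>

inductive symbolic_loop ::
  "('x, 'a::comm_ring_1) f45_state \<Rightarrow> nat set \<Rightarrow> ('x monomial \<times> nat) list \<Rightarrow> 'x monomial set
    \<Rightarrow> 'x monomial set \<Rightarrow> ('x monomial \<times> nat) list \<Rightarrow> 'x monomial set \<Rightarrow> bool"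
  for st :: "('x, 'a) f45_state" and G :: "nat set"
  where
    finish: "M = Done \<Longrightarrow> symbolic_loop st G F Done M F Done"
  | no_reductor:
      "\<lbrakk>M \<noteq> Done; \<mu> = mo.Max (M - Done); set ks = G; distinct ks;
        find_reductor st \<mu> ks F = None;
        symbolic_loop st G F (insert \<mu> Done) M F' Done'\<rbrakk>
       \<Longrightarrow> symbolic_loop st G F Done M F' Done'"
  | reductor:
      "\<lbrakk>M \<noteq> Done; \<mu> = mo.Max (M - Done); set ks = G; distinct ks;
        find_reductor st \<mu> ks F = Some (t, k);
        symbolic_loop st G (F @ [(t, k)]) (insert \<mu> Done)
          (M \<union> Poly_Mapping.keys (mmult t (poly_at st k))) F' Done'\<rbrakk>
       \<Longrightarrow> symbolic_loop st G F Done M F' Done'"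

definition symbolic_preprocessing ::
  "('x, 'a::comm_ring_1) f45_state \<Rightarrow> ('x monomial \<times> nat) set \<Rightarrow> nat set
    \<Rightarrow> ('x monomial \<times> nat) list \<Rightarrow> 'x monomial list \<Rightarrow> bool"
  where "symbolic_preprocessing st S G F T \<longleftrightarrow>
    (\<exists>F0 F1 Done.
       set F0 = S \<and> distinct F0 \<and>
       symbolic_loop st G F0 {} (\<Union>(u, k)\<in>S. Poly_Mapping.keys (mmult u (poly_at st k))) F1 Done \<and>
       mset F = mset F1 \<and>
       sorted_wrt (\<lambda>(u, k) (v, l). sig_le (sig_mult u (sig_at st k)) (sig_mult v (sig_at st l))) F \<and>
       set T = Done \<and> sorted_wrt (\<lambda>s t. t \<prec> s) T)"

text \<open>One pass through the loop of Reduction, for the entries \<open>F\<^sub>k = (u, i)\<close> and \<open>q\<close> of the input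
  and output of the elimination; the set is the output set being accumulated.\<close>

definition reduction_step ::
  "('x monomial \<times> nat) \<times> ('x, 'a::field) mpoly \<Rightarrow> ('x, 'a) f45_state \<times> nat set
    \<Rightarrow> ('x, 'a) f45_state \<times> nat set"
  where "reduction_step = (\<lambda>((u, i), q) (st, Fplus).
    if q \<noteq> 0 \<and> LM q = u + LM (poly_at st i) then (st, Fplus)
    else
      (let st' = append_labelled (sig_mult u (sig_at st i)) q st
       in (st', if q \<noteq> 0 then insert (length (labelled st') - 1) Fplus else Fplus)))"

definition reduction ::
  "('x, 'a::field) f45_state \<Rightarrow> ('x monomial \<times> nat) set \<Rightarrow> nat set
    \<Rightarrow> ('x, 'a) f45_state \<Rightarrow> nat set \<Rightarrow> bool"
  where "reduction st S G st' Fplus \<longleftrightarrow>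
    (\<exists>F T. symbolic_preprocessing st S G F T \<and>
       (st', Fplus) = fold reduction_step (zip F (gaussian_elimination st F T)) (st, {}))"


subsection \<open>Main algorithm\<close>

definition enter ::
  "('x, 'a::zero) f45_state \<Rightarrow> nat \<Rightarrow> nat set \<times> 'x critpair set \<Rightarrow> nat set \<times> 'x critpair set"
  where "enter st i = (\<lambda>(G, P). (insert i G, P \<union> {p. \<exists>j\<in>G. update st G i j = Some p}))"

definition add_input ::
  "nat \<times> ('x, 'a::field) mpoly \<Rightarrow> ('x, 'a) f45_state \<times> nat set \<times> 'x critpair set
    \<Rightarrow> ('x, 'a) f45_state \<times> nat set \<times> 'x critpair set"
  where "add_input = (\<lambda>(i, f) (st, GP).
    (let st' = append_labelled (0, i) (Poly_Mapping.single 0 (inverse (LC f)) * f) st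
     in (st', enter st' i GP)))"

definition initialise ::
  "('x, 'a::field) mpoly list \<Rightarrow> ('x, 'a) f45_state \<times> nat set \<times> 'x critpair set"
  where "initialise fs =
    fold add_input (zip [0..<length fs] fs) (\<lparr>labelled = [], rules = (\<lambda>_. [])\<rparr>, {}, {})"

text \<open>\<open>main_loop st G P B\<close>: the while-loop of the main algorithm, started with the global data
  \<open>st\<close> and the values \<open>G\<close>, \<open>P\<close>, terminates and \<open>B\<close> is returned.\<close>

inductive main_loop ::
  "('x, 'a::field) f45_state \<Rightarrow> nat set \<Rightarrow> 'x critpair set \<Rightarrow> ('x, 'a) mpoly set \<Rightarrow> bool"
  where
    finish: "main_loop st G {} (poly_at st ` G)"
  | step:
      "\<lbrakk>P \<noteq> {}; d = Min (pair_deg ` P); Pd = {p \<in> P. pair_deg p = d};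
        S = spolynomials st Pd;
        reduction st S G st' Fplus;
        set ks = Fplus; distinct ks;
        (G', P') = fold (enter st') ks (G, P - Pd);
        main_loop st' G' P' B\<rbrakk>
       \<Longrightarrow> main_loop st G P B"

text \<open>\<open>F45 fs B\<close>: some execution of the algorithm on the input \<open>fs\<close> terminates and returns \<open>B\<close>.\<close>

definition F45 :: "('x, 'a::field) mpoly list \<Rightarrow> ('x, 'a) mpoly set \<Rightarrow> bool"
  where "F45 fs B \<longleftrightarrow>
    (\<exists>fs' st G P.
       mset fs' = mset fs \<and> sorted (map total_degree fs') \<and>
       initialise fs' = (st, G, P) \<and>
       main_loop st G P B)"

end

end

theory Submission
  imports Defs
begin

text \<open>
  Call a multiple \<open>(u, k)\<close> with \<open>k \<in> G\<close> good if it passes the F5 criterion and is not rewritable.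
  The loop invariant is that any two elements of \<open>G\<close> whose cofactors in the lcm of their leading
  monomials are both good form a pair in \<open>P\<close>.  When the pairs of minimal degree are treated, the
  invariant and the minimality imply that of the good multiples with leading monomial \<open>t\<close> all but
  the one of least signature are already in the matrix as S-polynomials.  So FindReductor adds the
  last one if it is missing, the elimination changes the leading monomial of all others, and the new
  rules make those rewritable.

  When \<open>P\<close> is empty, there are thus no two distinct good multiples with the same leading monomial.
  By well-founded induction on the signature \<open>\<sigma>\<close>, every nonzero polynomial with a representation of
  signature less than \<open>\<sigma>\<close> has its leading monomial divisible by that of some element of \<open>G\<close>, with the
  multiple having signature less than \<open>\<sigma>\<close>, and a good multiple of signature \<open>\<sigma>\<close> has no such reducer:
  a polynomial of signature \<open>\<tau> < \<sigma>\<close> is compared with the rewriter of \<open>\<tau>\<close>, or with a trivial syzygy if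
  the F5 criterion applies to \<open>\<tau>\<close>.
\<close>

section \<open>Monomials and polynomials\<close>

text \<open>The case of a single exponent in Dickson's lemma. A monotone subsequence exists; if it
  is decreasing, it is constant once it has reached its least value, and that tail is
  nondecreasing.\<close>

lemma strict_mono_mono_subseq_nat:
  fixes s :: "nat \<Rightarrow> nat"
  obtains r :: "nat \<Rightarrow> nat" where "strict_mono r" "mono (\<lambda>n. s (r n))"
proof -
  obtain r where r: "strict_mono r" "monoseq (\<lambda>n. s (r n))"
    using seq_monosub[of s] by blast
  from r(2) consider (inc) "mono (\<lambda>n. s (r n))" | (dec) "antimono (\<lambda>n. s (r n))"
    unfolding monoseq_def mono_def antimono_def by blast
  then show thesis
  proof cases
    case inc
    with r(1) show thesis by (rule that)
  next
    case dec
    define y where "y = (LEAST y. y \<in> range (\<lambda>n. s (r n)))"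
    have "y \<in> range (\<lambda>n. s (r n))"
      unfolding y_def by (rule LeastI) (rule rangeI)
    then obtain N where N: "y = s (r N)" by blast
    have const: "s (r (n + N)) = y" for n
    proof (rule antisym)
      show "s (r (n + N)) \<le> y"
        unfolding N using antimonoD[OF dec, of N "n + N"] by simp
      show "y \<le> s (r (n + N))"
        unfolding y_def by (rule Least_le) blast
    qed
    show thesis
    proof (rule that)
      show "strict_mono (\<lambda>n. r (n + N))"
        using r(1) by (simp add: strict_mono_def)
      show "mono (\<lambda>n. s (r (n + N)))"
        by (simp add: const mono_def)
    qed
  qed
qed

text \<open>Passing to a subsequence keeps an exponent nondecreasing, so the finitely many variables
  can be treated one after the other. In the final subsequence each member divides the next.\<close>

lemma Dickson:
  fixes s :: "nat \<Rightarrow> 'x::finite monomial"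
  obtains i j where "i < j" "mdvd (s i) (s j)"
proof -
  have "\<exists>r :: nat \<Rightarrow> nat. strict_mono r \<and> (\<forall>x\<in>X. mono (\<lambda>n. Poly_Mapping.lookup (s (r n)) x))"
    if "finite X" for X :: "'x set"
    using that
  proof (induction X)
    case empty
    show ?case by (intro exI[of _ "\<lambda>n. n"]) (simp add: strict_mono_def)
  next
    case (insert y X)
    from insert.IH obtain r :: "nat \<Rightarrow> nat" where r: "strict_mono r"
      and X: "\<And>x. x \<in> X \<Longrightarrow> mono (\<lambda>n. Poly_Mapping.lookup (s (r n)) x)"
      by blast
    obtain r' :: "nat \<Rightarrow> nat" where r': "strict_mono r'" "mono (\<lambda>n. Poly_Mapping.lookup (s (r (r' n))) y)"
      using strict_mono_mono_subseq_nat[of "\<lambda>n. Poly_Mapping.lookup (s (r n)) y"] by blast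
    have "mono (\<lambda>n. Poly_Mapping.lookup (s (r (r' n))) x)" if "x \<in> X" for x
      using monoD[OF X[OF that]] monoD[OF strict_mono_mono[OF r'(1)]] by (intro monoI) blast
    moreover have "strict_mono (\<lambda>n. r (r' n))"
      using r r'(1) by (simp add: strict_mono_def)
    ultimately show ?case
      using r'(2) by (intro exI[of _ "\<lambda>n. r (r' n)"]) simp
  qed
  from this[of UNIV] obtain r :: "nat \<Rightarrow> nat" where r: "strict_mono r"
    and le: "\<And>x. mono (\<lambda>n. Poly_Mapping.lookup (s (r n)) x)"
    by auto
  have "s (r 1) = s (r 0) + (s (r 1) - s (r 0))"
    by (rule poly_mapping_eqI)
      (use monoD[OF le, of 0 1] in \<open>simp add: lookup_add lookup_minus\<close>)
  then have "mdvd (s (r 0)) (s (r 1))"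
    unfolding mdvd_def by blast
  moreover have "r 0 < r 1" using r by (simp add: strict_mono_def)
  ultimately show thesis by (rule that[rotated])
qed

section \<open>Divisibility, least common multiples and degrees of monomials\<close>

lemma mdvd_add [simp]: "mdvd s (u + s)" "mdvd s (s + u)"
  by (auto simp: mdvd_def add.commute)

lemma mdvd_refl [simp]: "mdvd s s"
  by (metis add.right_neutral mdvd_add(2))

lemma mdvd_zero [simp]: "mdvd 0 t"
  by (simp add: mdvd_def)

lemma mdvd_add_mono: "mdvd s t \<Longrightarrow> mdvd s (u + t)"
  by (metis add.assoc add.commute mdvd_def)

lemma mdvd_diff: "mdvd s t \<Longrightarrow> (t - s) + s = t"
  by (auto simp: mdvd_def add.commute)

lemma mdvd_iff_lookup:
  "mdvd s t \<longleftrightarrow> (\<forall>x. Poly_Mapping.lookup s x \<le> Poly_Mapping.lookup t x)"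
proof
  assume "\<forall>x. Poly_Mapping.lookup s x \<le> Poly_Mapping.lookup t x"
  then have "t = s + (t - s)"
    by (intro poly_mapping_eqI) (simp add: lookup_add lookup_minus)
  then show "mdvd s t" by (auto simp: mdvd_def)
qed (auto simp: mdvd_def lookup_add)

lemma mlcm_commute: "mlcm s t = mlcm t s"
  by (rule poly_mapping_eqI) (simp add: mlcm.rep_eq max.commute)

lemma mdvd_mlcm: "mdvd s (mlcm s t)" "mdvd t (mlcm s t)"
  by (auto simp: mdvd_iff_lookup mlcm.rep_eq)

lemma mlcm_least: "mdvd s u \<Longrightarrow> mdvd t u \<Longrightarrow> mdvd (mlcm s t) u"
  by (auto simp: mdvd_iff_lookup mlcm.rep_eq)

lemma mdeg_add: "mdeg (s + t) = mdeg s + mdeg t"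
  by (simp add: mdeg_def lookup_add sum.distrib)

lemma mdeg_eq_0: "mdeg t = 0 \<longleftrightarrow> t = 0"
  by (auto simp: mdeg_def intro!: poly_mapping_eqI)

section \<open>Products of polynomials with a single term\<close>

lemma lookup_single_times:
  fixes p :: "('x, 'a::semiring_0) mpoly"
  shows "Poly_Mapping.lookup (Poly_Mapping.single u c * p) s
    = (if mdvd u s then c * Poly_Mapping.lookup p (s - u) else 0)"
proof -
  have eq: "Poly_Mapping.lookup (Poly_Mapping.single u c * p) s
      = c * (\<Sum>q. Poly_Mapping.lookup p q when s = u + q)" for s
    by (simp add: lookup_mult lookup_single when_mult)
  show ?thesis
  proof (cases "mdvd u s")
    case True
    then obtain t where "s = u + t" by (auto simp: mdvd_def)
    then show ?thesis by (simp add: eq)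
  next
    case False
    then have "s \<noteq> u + q" for q
      by (auto simp: mdvd_def)
    then show ?thesis using False by (simp add: eq)
  qed
qed

lemma keys_single_times:
  fixes p :: "('x, 'a::field) mpoly"
  assumes "c \<noteq> 0"
  shows "Poly_Mapping.keys (Poly_Mapping.single u c * p) = (+) u ` Poly_Mapping.keys p"
proof (intro set_eqI iffI)
  fix s assume "s \<in> Poly_Mapping.keys (Poly_Mapping.single u c * p)"
  then have "mdvd u s" "s - u \<in> Poly_Mapping.keys p"
    by (auto simp: in_keys_iff lookup_single_times split: if_splits)
  then show "s \<in> (+) u ` Poly_Mapping.keys p"
    by (metis add.commute image_eqI mdvd_diff)
next
  fix s assume "s \<in> (+) u ` Poly_Mapping.keys p"
  then obtain t where "t \<in> Poly_Mapping.keys p" "s = u + t" by blast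
  then show "s \<in> Poly_Mapping.keys (Poly_Mapping.single u c * p)"
    using assms by (simp add: in_keys_iff lookup_single_times)
qed

lemma single_times_eq_0_iff:
  fixes p :: "('x, 'a::field) mpoly"
  shows "Poly_Mapping.single u c * p = 0 \<longleftrightarrow> c = 0 \<or> p = 0"
  using keys_single_times[of c u p] by (cases "c = 0") (simp_all flip: keys_eq_empty)

lemma sum_single_keys:
  "(\<Sum>t\<in>Poly_Mapping.keys p. Poly_Mapping.single t (Poly_Mapping.lookup p t)) = p"
  by (rule poly_mapping_eqI)
    (auto simp: lookup_sum lookup_single when_def in_keys_iff)


section \<open>Signatures\<close>

context monomial_ordering
begin

lemma mult_strict_mono: "s \<prec> t \<Longrightarrow> u + s \<prec> u + t"
  using mult_mono[of s t u] by (auto simp: mo.less_le)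

lemma mult_cancel_less [simp]: "u + s \<prec> u + t \<longleftrightarrow> s \<prec> t"
  using mult_strict_mono[of s t u] mult_mono[of t s u] by (auto simp flip: mo.not_le)

lemma le_multiple: "s \<preceq> u + s"
  using mult_mono[OF one_least, of s u] by (simp add: add.commute)

text \<open>By Dickson's lemma a descending chain would contain a monomial dividing a later one, but
  a multiple is never smaller than its divisor.\<close>

lemma wfp_lt: "wfp (\<prec>)"
  unfolding wfp_def wf_iff_no_infinite_down_chain mem_Collect_eq case_prod_conv
proof
  assume "\<exists>s. \<forall>i. s (Suc i) \<prec> s i"
  then obtain s where s: "\<And>i. s (Suc i) \<prec> s i" by blast
  have desc: "s j \<prec> s i" if "i < j" for i j
    using that by (induction rule: less_Suc_induct) (rule s, erule (1) mo.less_trans[rotated])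
  obtain i j where "i < j" "mdvd (s i) (s j)" by (rule Dickson)
  then obtain u where "s j = u + s i" by (auto simp: mdvd_def add.commute)
  then show False
    using desc[OF \<open>i < j\<close>] le_multiple[of "s i" u] by (simp add: mo.not_le)
qed

section \<open>The order on signatures\<close>

lemma sig_less_irrefl [simp]: "\<not> sig_less \<sigma> \<sigma>"
  by (simp add: sig_less_def)

lemma sig_less_trans: "sig_less \<rho> \<sigma> \<Longrightarrow> sig_less \<sigma> \<tau> \<Longrightarrow> sig_less \<rho> \<tau>"
  by (auto simp: sig_less_def intro: mo.less_trans)

lemma sig_less_linear: "sig_less \<sigma> \<tau> \<or> \<sigma> = \<tau> \<or> sig_less \<tau> \<sigma>"
  using mo.less_linear[of "fst \<sigma>" "fst \<tau>"] by (auto simp: sig_less_def prod_eq_iff)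

lemma sig_less_mult: "sig_less (sig_mult u \<sigma>) (sig_mult u \<tau>) \<longleftrightarrow> sig_less \<sigma> \<tau>"
  by (auto simp: sig_less_def sig_mult_def)

text \<open>A lexicographic product of two well-founded orders. The index is compared first, so the
  components of the pair are exchanged.\<close>

lemma wfp_sig_less: "wfp sig_less"
proof -
  have "wf (inv_image ({(i, j :: nat). i < j} <*lex*> {(s, t). s \<prec> t}) (\<lambda>\<sigma>. (snd \<sigma>, fst \<sigma>)))"
    using wfp_lt by (intro wf_inv_image wf_lex_prod) (auto simp: wfp_def wf)
  then show ?thesis
    unfolding wfp_def by (rule wf_subset) (auto simp: sig_less_def inv_image_def)
qed


subsection \<open>Leading monomials\<close>

lemma LM_in_keys: "p \<noteq> 0 \<Longrightarrow> LM p \<in> Poly_Mapping.keys p"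
  unfolding LM_def by (rule mo.Max_in) auto

lemma LM_ge: "s \<in> Poly_Mapping.keys p \<Longrightarrow> s \<preceq> LM p"
  unfolding LM_def by (rule mo.Max_ge) auto

lemma LM_eqI:
  "t \<in> Poly_Mapping.keys p \<Longrightarrow> (\<And>s. s \<in> Poly_Mapping.keys p \<Longrightarrow> s \<preceq> t) \<Longrightarrow> LM p = t"
  unfolding LM_def by (rule mo.Max_eqI) auto

lemma LM_single_times:
  fixes p :: "('x, 'a::field) mpoly"
  assumes "c \<noteq> 0" "p \<noteq> 0"
  shows "LM (Poly_Mapping.single u c * p) = u + LM p"
  using assms by (intro LM_eqI) (auto simp: keys_single_times LM_in_keys LM_ge mult_mono)

lemma LM_mmult:
  fixes p :: "('x, 'a::field) mpoly"
  shows "p \<noteq> 0 \<Longrightarrow> LM (mmult u p) = u + LM p"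
  by (simp add: mmult_def LM_single_times)

text \<open>Every monomial of \<open>p\<close> is smaller than \<open>LM q\<close>, which therefore
  survives in the difference. The case \<open>p = 0\<close> is listed separately because
  \<open>LM 0\<close> has no meaning.\<close>

lemma LM_minus_right:
  fixes p q :: "('x, 'a::field) mpoly"
  assumes "q \<noteq> 0" "p = 0 \<or> LM p \<prec> LM q"
  shows "p - q \<noteq> 0" "LM (p - q) = LM q"
proof -
  have *: "LM q \<notin> Poly_Mapping.keys p"
    using assms(2) LM_ge[of "LM q" p] by auto
  then have key: "LM q \<in> Poly_Mapping.keys (p - q)"
    using LM_in_keys[OF assms(1)] by (simp add: in_keys_iff lookup_minus)
  then show "p - q \<noteq> 0" by auto
  show "LM (p - q) = LM q"
  proof (rule LM_eqI[OF key])
    fix s assume "s \<in> Poly_Mapping.keys (p - q)"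
    then have "s \<in> Poly_Mapping.keys p \<or> s \<in> Poly_Mapping.keys q"
      by (auto simp: in_keys_iff lookup_minus)
    then show "s \<preceq> LM q"
      using LM_ge assms(2) mo.le_less_trans mo.less_imp_le by (metis keys_zero empty_iff)
  qed
qed

lemma LM_minus_left:
  fixes p q :: "('x, 'a::field) mpoly"
  assumes "p \<noteq> 0" "LM q \<prec> LM p"
  shows "p - q \<noteq> 0" "LM (p - q) = LM p"
proof -
  have "Poly_Mapping.keys (p - q) = Poly_Mapping.keys (q - p)"
    by (auto simp: in_keys_iff lookup_minus)
  then show "p - q \<noteq> 0" "LM (p - q) = LM p"
    using LM_minus_right[of p q] assms unfolding LM_def by auto
qed


subsection \<open>Polynomials with a representation of given signature\<close>

text \<open>\<open>lower fs \<sigma>\<close> is the image of the vectors of signature less than \<open>\<sigma>\<close> under \<open>e\<^sub>j \<mapsto> fs ! j\<close>, and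
  \<open>has_sig fs p \<sigma>\<close> says that \<open>p\<close> is the image of a vector of signature \<open>\<sigma>\<close>.  Neither the vector
  nor the signature is determined by \<open>p\<close>.\<close>

inductive_set lower :: "('x, 'a::field) mpoly list \<Rightarrow> 'x signature \<Rightarrow> ('x, 'a) mpoly set"
  for fs \<sigma>
  where
    zero: "0 \<in> lower fs \<sigma>"
  | add: "\<lbrakk>p \<in> lower fs \<sigma>; j < length fs; sig_less (s, j) \<sigma>\<rbrakk>
      \<Longrightarrow> Poly_Mapping.single s c * fs ! j + p \<in> lower fs \<sigma>"

definition has_sig :: "('x, 'a::field) mpoly list \<Rightarrow> ('x, 'a) mpoly \<Rightarrow> 'x signature \<Rightarrow> bool"
  where "has_sig fs p \<sigma> \<longleftrightarrow> snd \<sigma> < length fs \<and>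
    (\<exists>c v. c \<noteq> 0 \<and> v \<in> lower fs \<sigma> \<and> p = Poly_Mapping.single (fst \<sigma>) c * fs ! snd \<sigma> + v)"

section \<open>Closure properties of \<open>lower\<close>\<close>

lemma lower_add: "p \<in> lower fs \<sigma> \<Longrightarrow> q \<in> lower fs \<sigma> \<Longrightarrow> p + q \<in> lower fs \<sigma>"
  by (induction rule: lower.induct) (auto simp: add.assoc intro: lower.add)

lemma lower_sum: "(\<And>x. x \<in> X \<Longrightarrow> f x \<in> lower fs \<sigma>) \<Longrightarrow> sum f X \<in> lower fs \<sigma>"
  by (induction X rule: infinite_finite_induct) (auto intro: lower.zero lower_add)

lemma lower_single_times:
  "p \<in> lower fs \<sigma> \<Longrightarrow> Poly_Mapping.single u c * p \<in> lower fs (sig_mult u \<sigma>)"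
proof (induction rule: lower.induct)
  case (add p j s d)
  have "sig_less (u + s, j) (sig_mult u \<sigma>)"
    using add.hyps sig_less_mult[of u "(s, j)" \<sigma>] by (simp add: sig_mult_def)
  from lower.add[OF add.IH add.hyps(2) this, of "c * d"] show ?case
    by (simp add: distrib_left mult_single flip: mult.assoc)
qed (simp add: lower.zero)

lemma lower_scale: "p \<in> lower fs \<sigma> \<Longrightarrow> Poly_Mapping.single 0 c * p \<in> lower fs \<sigma>"
  using lower_single_times[of p fs \<sigma> 0 c] by (simp add: sig_mult_def)

lemma lower_uminus: "p \<in> lower fs \<sigma> \<Longrightarrow> - p \<in> lower fs \<sigma>"
  using lower_scale[of p fs \<sigma> "-1"] by (simp add: single_uminus)

lemma lower_diff: "p \<in> lower fs \<sigma> \<Longrightarrow> q \<in> lower fs \<sigma> \<Longrightarrow> p - q \<in> lower fs \<sigma>"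
  using lower_add[of p fs \<sigma> "- q"] lower_uminus[of q fs \<sigma>] by simp

lemma lower_mono: "p \<in> lower fs \<sigma> \<Longrightarrow> sig_less \<sigma> \<tau> \<Longrightarrow> p \<in> lower fs \<tau>"
  by (induction rule: lower.induct) (auto intro: lower.intros sig_less_trans)

lemma single_times_lower:
  "j < length fs \<Longrightarrow> sig_less (s, j) \<sigma> \<Longrightarrow> Poly_Mapping.single s c * fs ! j \<in> lower fs \<sigma>"
  using lower.add[OF lower.zero, where c = c] by (metis add.right_neutral)

lemma sig_less_zero_iff: "sig_less (s, j) (0, i) \<longleftrightarrow> j < i"
  using one_least[of s] by (auto simp: sig_less_def)

text \<open>All signatures of index less than \<open>i\<close> lie below \<open>(0, i)\<close>,
  whatever their monomial. So \<open>lower fs (0, i)\<close> is an ideal, whereas for other \<sigma>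
  a product with a large monomial may leave \<open>lower fs \<sigma>\<close>.\<close>

lemma times_lower_zero: "p \<in> lower fs (0, i) \<Longrightarrow> q * p \<in> lower fs (0, i)"
proof (induction rule: lower.induct)
  case (add p j s c)
  have "q * (Poly_Mapping.single s c * fs ! j)
      = (\<Sum>t\<in>Poly_Mapping.keys q.
           Poly_Mapping.single (t + s) (Poly_Mapping.lookup q t * c) * fs ! j)"
    by (subst sum_single_keys[of q, symmetric])
      (simp only: sum_distrib_right mult_single flip: mult.assoc)
  also have "\<dots> \<in> lower fs (0, i)"
    using add.hyps by (intro lower_sum single_times_lower) (auto simp: sig_less_zero_iff)
  finally show ?case using add.IH by (simp add: distrib_left lower_add)
qed (simp add: lower.zero)

lemma times_nth_lower:
  assumes "i < length fs" "\<And>s. s \<in> Poly_Mapping.keys q \<Longrightarrow> s \<prec> t"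
  shows "q * fs ! i \<in> lower fs (t, i)"
proof -
  have "q * fs ! i = (\<Sum>s\<in>Poly_Mapping.keys q.
      Poly_Mapping.single s (Poly_Mapping.lookup q s) * fs ! i)"
    by (subst sum_single_keys[of q, symmetric]) (simp only: sum_distrib_right)
  also have "\<dots> \<in> lower fs (t, i)"
    using assms by (intro lower_sum single_times_lower) (auto simp: sig_less_def)
  finally show ?thesis .
qed

section \<open>Polynomials of a given signature\<close>

lemma has_sig_lower: "has_sig fs p \<sigma> \<Longrightarrow> sig_less \<sigma> \<tau> \<Longrightarrow> p \<in> lower fs \<tau>"
  unfolding has_sig_def
  by (metis lower_add lower_mono prod.collapse single_times_lower)

lemma has_sig_single_times:
  assumes "has_sig fs p \<sigma>" "c \<noteq> 0"
  shows "has_sig fs (Poly_Mapping.single u c * p) (sig_mult u \<sigma>)"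
proof -
  obtain d v where dv: "d \<noteq> 0" "v \<in> lower fs \<sigma>" "snd \<sigma> < length fs"
    and p: "p = Poly_Mapping.single (fst \<sigma>) d * fs ! snd \<sigma> + v"
    using assms(1) unfolding has_sig_def by blast
  have "Poly_Mapping.single u c * p
      = Poly_Mapping.single (u + fst \<sigma>) (c * d) * fs ! snd \<sigma> + Poly_Mapping.single u c * v"
    by (simp add: p distrib_left mult_single flip: mult.assoc)
  moreover have "Poly_Mapping.single u c * v \<in> lower fs (sig_mult u \<sigma>)"
    using dv(2) by (rule lower_single_times)
  moreover have "c * d \<noteq> 0" using assms(2) dv(1) by simp
  ultimately show ?thesis
    using dv(3) unfolding has_sig_def sig_mult_def fst_conv snd_conv by blast
qed

lemma has_sig_mmult: "has_sig fs p \<sigma> \<Longrightarrow> has_sig fs (mmult u p) (sig_mult u \<sigma>)"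
  by (simp add: mmult_def has_sig_single_times)

lemma has_sig_scale: "has_sig fs p \<sigma> \<Longrightarrow> c \<noteq> 0 \<Longrightarrow> has_sig fs (Poly_Mapping.single 0 c * p) \<sigma>"
  using has_sig_single_times[of fs p \<sigma> c 0] by (simp add: sig_mult_def)

lemma has_sig_add_lower: "has_sig fs p \<sigma> \<Longrightarrow> v \<in> lower fs \<sigma> \<Longrightarrow> has_sig fs (p + v) \<sigma>"
  unfolding has_sig_def by (elim conjE exE) (simp add: add.assoc, blast intro: lower_add)

text \<open>The quotient of the two coefficients at the common signature makes the top terms cancel,
  which leaves a vector of smaller signature.\<close>

lemma has_sig_cancel:
  assumes "has_sig fs p \<sigma>" "has_sig fs q \<sigma>"
  obtains c where "c \<noteq> 0" "p - Poly_Mapping.single 0 c * q \<in> lower fs \<sigma>"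
proof -
  obtain a v where a: "a \<noteq> 0" "v \<in> lower fs \<sigma>"
    and p: "p = Poly_Mapping.single (fst \<sigma>) a * fs ! snd \<sigma> + v"
    using assms(1) unfolding has_sig_def by blast
  obtain b w where b: "b \<noteq> 0" "w \<in> lower fs \<sigma>"
    and q: "q = Poly_Mapping.single (fst \<sigma>) b * fs ! snd \<sigma> + w"
    using assms(2) unfolding has_sig_def by blast
  have "p - Poly_Mapping.single 0 (a / b) * q = v - Poly_Mapping.single 0 (a / b) * w"
    using b(1) by (simp add: p q distrib_left mult_single flip: mult.assoc)
  also have "\<dots> \<in> lower fs \<sigma>" using a(2) b(2) by (intro lower_diff lower_scale)
  finally show thesis by (rule that[rotated]) (use a b in simp)
qed

text \<open>Turns a bound on the signature into one smaller signature \<tau>, to which an induction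
  hypothesis can be applied.\<close>

lemma lower_signature:
  assumes "p \<in> lower fs \<sigma>"
  shows "p = 0 \<or> (\<exists>\<tau>. sig_less \<tau> \<sigma> \<and> (p \<in> lower fs \<tau> \<or> has_sig fs p \<tau>))"
proof -
  \<comment> \<open>The induction follows the largest signature \<tau> in the sum. Its coefficient
    \<open>c\<close> may become 0 when two terms of signature \<tau> meet; then \<open>p\<close>
    lies in \<open>lower fs \<tau>\<close>, which explains the two alternatives of the
    lemma.\<close>
  have "p = 0 \<or> (\<exists>\<tau> c v. sig_less \<tau> \<sigma> \<and> snd \<tau> < length fs \<and> v \<in> lower fs \<tau>
      \<and> p = Poly_Mapping.single (fst \<tau>) c * fs ! snd \<tau> + v)"
    using assms
  proof (induction rule: lower.induct)
    case zero
    then show ?case by simp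
  next
    case (add p j s d)
    from add.IH show ?case
    proof (elim disjE exE conjE)
      assume "p = 0"
      then show ?thesis
        using add.hyps lower.zero
        by (intro disjI2 exI[of _ "(s, j)"] exI[of _ d] exI[of _ 0]) simp
    next
      fix \<tau> c v
      assume \<tau>: "sig_less \<tau> \<sigma>" "snd \<tau> < length fs" "v \<in> lower fs \<tau>"
        and p: "p = Poly_Mapping.single (fst \<tau>) c * fs ! snd \<tau> + v"
      consider "sig_less (s, j) \<tau>" | "\<tau> = (s, j)" | "sig_less \<tau> (s, j)"
        using sig_less_linear by blast
      then show ?thesis
      proof cases
        case 1
        have "Poly_Mapping.single s d * fs ! j + p
            = Poly_Mapping.single (fst \<tau>) c * fs ! snd \<tau> + (Poly_Mapping.single s d * fs ! j + v)"
          by (simp add: p)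
        moreover have "Poly_Mapping.single s d * fs ! j + v \<in> lower fs \<tau>"
          using \<tau>(3) add.hyps(2) 1 by (rule lower.add)
        ultimately show ?thesis using \<tau> by blast
      next
        case 2
        have "Poly_Mapping.single s d * fs ! j + p
            = Poly_Mapping.single (fst \<tau>) (d + c) * fs ! snd \<tau> + v"
          by (simp add: p 2 single_add distrib_right)
        then show ?thesis using \<tau> by blast
      next
        case 3
        have "p \<in> lower fs (s, j)"
          using \<tau> 3 unfolding p
          by (intro lower_add single_times_lower) (auto intro: lower_mono)
        then show ?thesis
          using add.hyps by (intro disjI2 exI[of _ "(s, j)"] exI[of _ d] exI[of _ p]) simp
      qed
    qed
  qed
  then show ?thesis
  proof (elim disjE exE conjE)
    fix \<tau> c v
    assume \<tau>: "sig_less \<tau> \<sigma>" "snd \<tau> < length fs" "v \<in> lower fs \<tau>"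
      and p: "p = Poly_Mapping.single (fst \<tau>) c * fs ! snd \<tau> + v"
    then have "p \<in> lower fs \<tau> \<or> has_sig fs p \<tau>"
      by (cases "c = 0") (auto simp: has_sig_def)
    with \<tau>(1) show ?thesis by blast
  qed simp
qed

text \<open>The F5 criterion: the trivial syzygy between \<open>fs ! i\<close> and an earlier \<open>g\<close> lowers the signature.\<close>

lemma has_sig_top_reducible:
  assumes g: "has_sig fs g \<tau>" "g \<noteq> 0" and i: "snd \<tau> < i" "mdvd (LM g) t"
    and p: "has_sig fs p (t, i)"
  shows "p \<in> lower fs (t, i)"
proof -
  obtain w where t: "t = w + LM g" using i(2) by (auto simp: mdvd_def add.commute)
  have len: "i < length fs" using p by (simp add: has_sig_def)
  \<comment> \<open>\<open>h\<close> is the multiple of \<open>g\<close> with leading monomial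
    \<open>t\<close> and leading coefficient 1, and \<open>r\<close> below is its tail. So
    \<open>t\<close> times \<open>fs ! i\<close> equals \<open>fs ! i * h - r * fs ! i\<close>,
    where the first product has smaller index and the second involves only monomials below
    \<open>t\<close>.\<close>
  define h where "h = Poly_Mapping.single w (inverse (LC g)) * g"
  have LC: "LC g \<noteq> 0" using LM_in_keys[OF g(2)] by (simp add: LC_def in_keys_iff)
  define r where "r = h - Poly_Mapping.single t 1"
  have "g \<in> lower fs (0, i)"
    using g(1) i(1) by (auto intro: has_sig_lower simp: sig_less_def)
  then have "fs ! i * h \<in> lower fs (0, i)"
    unfolding h_def by (simp add: times_lower_zero)
  then have 1: "fs ! i * h \<in> lower fs (t, i)"
    by (cases "t = 0") (auto intro: lower_mono simp: sig_less_def one_least mo.less_le)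
  have "s \<prec> t" if "s \<in> Poly_Mapping.keys r" for s
  proof -
    have "s \<noteq> t"
      using that LC by (auto simp: r_def h_def in_keys_iff lookup_minus lookup_single_times t LC_def)
    then have "s \<in> Poly_Mapping.keys h"
      using that by (auto simp: r_def in_keys_iff lookup_minus lookup_single)
    then have "s \<preceq> t"
      using LC by (auto simp: h_def keys_single_times t LM_ge mult_mono)
    with \<open>s \<noteq> t\<close> show ?thesis by (simp add: mo.less_le)
  qed
  then have 2: "r * fs ! i \<in> lower fs (t, i)"
    using len by (intro times_nth_lower)
  have "Poly_Mapping.single t 1 * fs ! i = fs ! i * h - r * fs ! i"
    by (simp add: r_def algebra_simps)
  also have "\<dots> \<in> lower fs (t, i)" using 1 2 by (rule lower_diff)
  finally have "Poly_Mapping.single 0 c * (Poly_Mapping.single t 1 * fs ! i) \<in> lower fs (t, i)" for c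
    by (rule lower_scale)
  then have "Poly_Mapping.single t c * fs ! i \<in> lower fs (t, i)" for c
    by (simp add: mult_single flip: mult.assoc)
  then show ?thesis
    using p unfolding has_sig_def by (auto intro: lower_add)
qed

text \<open>Every signature with an index less than \<open>length fs\<close> lies below
  \<open>(0, length fs)\<close>, so here the bound excludes nothing. A claim about all sets
  \<open>lower fs \<sigma>\<close> thus covers the ideal.\<close>

lemma ideal_gen_eq_lower: "ideal_gen (set fs) = lower fs (0, length fs)"
proof
  have "module.subspace (*) (lower fs (0, length fs))"
    by (rule module.subspaceI[OF module_times])
      (rule lower.zero, erule (1) lower_add, erule times_lower_zero)
  moreover have "set fs \<subseteq> lower fs (0, length fs)"
  proof
    fix f assume "f \<in> set fs"
    then obtain j where j: "j < length fs" "f = fs ! j" by (metis in_set_conv_nth)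
    have "Poly_Mapping.single 0 1 * fs ! j \<in> lower fs (0, length fs)"
      using j(1) by (intro single_times_lower) (auto simp: sig_less_def)
    then show "f \<in> lower fs (0, length fs)" by (simp add: j(2))
  qed
  ultimately show "ideal_gen (set fs) \<subseteq> lower fs (0, length fs)"
    unfolding ideal_gen_def by (rule module.span_minimal[OF module_times, rotated])
next
  show "lower fs (0, length fs) \<subseteq> ideal_gen (set fs)"
  proof
    fix p assume "p \<in> lower fs (0, length fs)"
    then show "p \<in> ideal_gen (set fs)"
    proof (induction rule: lower.induct)
      case zero
      show ?case unfolding ideal_gen_def by (rule module.span_zero[OF module_times])
    next
      case (add p j s c)
      have "fs ! j \<in> ideal_gen (set fs)"
        unfolding ideal_gen_def using add.hyps(2)
        by (intro module.span_base[OF module_times] nth_mem)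
      then have "Poly_Mapping.single s c * fs ! j \<in> ideal_gen (set fs)"
        unfolding ideal_gen_def by (rule module.span_scale[OF module_times])
      then show ?case
        using add.IH unfolding ideal_gen_def by (rule module.span_add[OF module_times])
    qed
  qed
qed

end


section \<open>Gaussian elimination\<close>

text \<open>Unfolds the choice of the pivot once and for all. The rescaling of the pivot row and the
  subtractions are merged into one formula in the old matrix \<open>A\<close>.\<close>

lemma eliminate_column_cases:
  fixes A :: "nat \<Rightarrow> nat \<Rightarrow> 'a::field"
  obtains (no_pivot) "\<nexists>r. r < M \<and> A r c \<noteq> 0 \<and> (\<forall>j<c. A r j = 0)" "eliminate_column M c A = A"
  | (pivot) r where "r < M" "A r c \<noteq> 0" "\<And>j. j < c \<Longrightarrow> A r j = 0"
    "\<And>s. s < M \<Longrightarrow> A s c \<noteq> 0 \<Longrightarrow> (\<forall>j<c. A s j = 0) \<Longrightarrow> r \<le> s"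
    "eliminate_column M c A = (\<lambda>i. if i = r then (\<lambda>j. A r j / A r c)
        else if r < i \<and> i < M \<and> A i c \<noteq> 0 then (\<lambda>j. A i j - A i c * (A r j / A r c)) else A i)"
proof (cases "\<exists>r. r < M \<and> A r c \<noteq> 0 \<and> (\<forall>j<c. A r j = 0)")
  case False
  then have "eliminate_column M c A = A"
    by (simp only: eliminate_column_def Let_def if_False)
  with False show thesis by (rule no_pivot)
next
  case True
  define P where "P = (\<lambda>r. r < M \<and> A r c \<noteq> 0 \<and> (\<forall>j<c. A r j = 0))"
  define r where "r = (LEAST r. P r)"
  have r: "P r" unfolding r_def using True unfolding P_def by (rule LeastI_ex)
  have least: "r \<le> s" if "P s" for s unfolding r_def using that by (rule Least_le)
  show thesis
  proof (rule pivot)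
    show "r < M" "A r c \<noteq> 0" "\<And>j. j < c \<Longrightarrow> A r j = 0"
      using r by (auto simp: P_def)
    show "r \<le> s" if "s < M" "A s c \<noteq> 0" "\<forall>j<c. A s j = 0" for s
      using that by (intro least) (simp add: P_def)
    show "eliminate_column M c A = (\<lambda>i. if i = r then (\<lambda>j. A r j / A r c)
        else if r < i \<and> i < M \<and> A i c \<noteq> 0 then (\<lambda>j. A i j - A i c * (A r j / A r c)) else A i)"
      unfolding eliminate_column_def Let_def P_def[symmetric] r_def[symmetric]
      using r by (auto simp: fun_eq_iff)
  qed
qed

lemma eliminate_column_unchanged:
  fixes A :: "nat \<Rightarrow> nat \<Rightarrow> 'a::field"
  assumes "A i c = 0"
  shows "eliminate_column M c A i = A i"
  using assms by (cases rule: eliminate_column_cases[of M A c]) auto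

text \<open>The pivot row for column \<open>c'\<close> vanishes in all columns before
  \<open>c'\<close>, so subtracting a multiple of it cannot refill column \<open>c\<close>.\<close>

lemma eliminate_column_preserves_zero:
  fixes A :: "nat \<Rightarrow> nat \<Rightarrow> 'a::field"
  assumes "A i c = 0" "c < c'"
  shows "eliminate_column M c' A i c = 0"
  using assms by (cases rule: eliminate_column_cases[of M A c']) auto

text \<open>Row \<open>a\<close> qualifies as pivot, so the topmost pivot \<open>r\<close> is at
  most \<open>a\<close> and hence lies above \<open>b\<close>, whose entry is cleared.\<close>

lemma eliminate_column_zero:
  fixes A :: "nat \<Rightarrow> nat \<Rightarrow> 'a::field"
  assumes "a < b" "b < M" "A a c \<noteq> 0" "\<And>j. j < c \<Longrightarrow> A a j = 0"
  shows "eliminate_column M c A b c = 0"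
proof (cases rule: eliminate_column_cases[of M A c])
  case no_pivot
  then show ?thesis using assms less_trans by blast
next
  case (pivot r)
  have "r \<le> a" using pivot(4)[of a] assms by simp
  then show ?thesis using pivot(2,5) assms(1,2) by simp
qed

text \<open>Row \<open>a\<close> starts at column \<open>c\<close>, so it is untouched until this
  column is treated. Then every row below loses its entry there, and later columns do not restore
  it.\<close>

lemma fold_eliminate_column_zero:
  fixes A :: "nat \<Rightarrow> nat \<Rightarrow> 'a::field"
  assumes "c < N" "a < b" "b < M" "A a c \<noteq> 0" "\<And>j. j < c \<Longrightarrow> A a j = 0"
  shows "fold (eliminate_column M) [0..<N] A b c = 0"
proof -
  have before: "fold (eliminate_column M) [0..<n] A a = A a" if "n \<le> c" for n
    using that
  proof (induction n)
    case (Suc n)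
    then show ?case
      using assms(5)[of n] by (simp add: eliminate_column_unchanged)
  qed simp
  have "fold (eliminate_column M) [0..<n] A b c = 0" if "Suc c \<le> n" for n
    using that
  proof (induction n rule: dec_induct)
    case base
    then show ?case
      using before[of c] assms by (simp add: eliminate_column_zero)
  next
    case (step n)
    then show ?case by (simp add: eliminate_column_preserves_zero)
  qed
  then show ?thesis using assms(1) by simp
qed

lemma lookup_sum_single_nth:
  assumes "distinct T" "c < length T"
  shows "Poly_Mapping.lookup (\<Sum>j<length T. Poly_Mapping.single (T ! j) (a j)) (T ! c) = a c"
proof -
  have "Poly_Mapping.lookup (\<Sum>j<length T. Poly_Mapping.single (T ! j) (a j)) (T ! c)
      = (\<Sum>j<length T. if j = c then a j else 0)"
    unfolding lookup_sum using assms
    by (intro sum.cong) (auto simp: lookup_single when_def nth_eq_iff_index_eq)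
  then show ?thesis using assms(2) by simp
qed

lemma sum_single_nth_lookup:
  assumes "distinct T" "Poly_Mapping.keys p \<subseteq> set T"
  shows "(\<Sum>j<length T. Poly_Mapping.single (T ! j) (Poly_Mapping.lookup p (T ! j))) = p"
proof -
  have "(\<Sum>j<length T. Poly_Mapping.single (T ! j) (Poly_Mapping.lookup p (T ! j)))
      = (\<Sum>t\<in>set T. Poly_Mapping.single t (Poly_Mapping.lookup p t))"
    using assms(1) by (intro sum.reindex_bij_betw bij_betw_nth) auto
  also have "\<dots> = (\<Sum>t\<in>Poly_Mapping.keys p. Poly_Mapping.single t (Poly_Mapping.lookup p t))"
    using assms(2) by (intro sum.mono_neutral_right) (auto simp: in_keys_iff)
  finally show ?thesis by (simp add: sum_single_keys)
qed

context monomial_ordering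
begin

text \<open>Every row is only changed by multiples of rows of smaller signature, hence keeps its signature.\<close>

lemma eliminate_column_has_sig:
  fixes A :: "nat \<Rightarrow> nat \<Rightarrow> 'a::field" and T :: "'x monomial list"
  defines "row \<equiv> \<lambda>A (i :: nat). \<Sum>j<length T. Poly_Mapping.single (T ! j) (A i j :: 'a)"
  assumes sig: "\<And>i. i < M \<Longrightarrow> has_sig fs (row A i) (\<sigma> i)"
    and less: "\<And>i j. i < j \<Longrightarrow> j < M \<Longrightarrow> sig_less (\<sigma> i) (\<sigma> j)"
    and i: "i < M"
  shows "has_sig fs (row (eliminate_column M c A) i) (\<sigma> i)"
proof (cases rule: eliminate_column_cases[of M A c])
  case no_pivot
  then show ?thesis using sig i by simp
next
  case (pivot r)
  consider "i = r" | "r < i" "A i c \<noteq> 0" | "i \<noteq> r" "\<not> (r < i \<and> A i c \<noteq> 0)" by blast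
  then show ?thesis
  proof cases
    case 1
    have "row (eliminate_column M c A) i = Poly_Mapping.single 0 (1 / A r c) * row A r"
      unfolding row_def pivot(5) sum_distrib_left using 1 by (simp add: mult_single)
    then show ?thesis using has_sig_scale[OF sig[OF pivot(1)]] pivot(2) 1 by simp
  next
    case 2
    have "row (eliminate_column M c A) i
        = row A i - Poly_Mapping.single 0 (A i c / A r c) * row A r"
      unfolding row_def pivot(5) sum_distrib_left using 2 i
      by (simp add: mult_single single_diff sum_subtractf)
    moreover have "- (Poly_Mapping.single 0 (A i c / A r c) * row A r) \<in> lower fs (\<sigma> i)"
      using sig[OF pivot(1)] less[OF 2(1) i] by (intro lower_uminus lower_scale has_sig_lower)
    ultimately show ?thesis using has_sig_add_lower[OF sig[OF i]] by fastforce
  next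
    case 3
    then have "row (eliminate_column M c A) i = row A i"
      unfolding row_def pivot(5) by simp
    then show ?thesis using sig[OF i] by simp
  qed
qed

lemma fold_eliminate_column_has_sig:
  fixes A :: "nat \<Rightarrow> nat \<Rightarrow> 'a::field" and T :: "'x monomial list"
  defines "row \<equiv> \<lambda>A (i :: nat). \<Sum>j<length T. Poly_Mapping.single (T ! j) (A i j :: 'a)"
  assumes "\<And>i. i < M \<Longrightarrow> has_sig fs (row A i) (\<sigma> i)"
    and "\<And>i j. i < j \<Longrightarrow> j < M \<Longrightarrow> sig_less (\<sigma> i) (\<sigma> j)"
  shows "i < M \<Longrightarrow> has_sig fs (row (fold (eliminate_column M) cs A) i) (\<sigma> i)"
  using assms(2)
proof (induction cs arbitrary: A i)
  case (Cons c cs)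
  have "has_sig fs (row (eliminate_column M c A) i) (\<sigma> i)" if "i < M" for i
    using Cons.prems(2) assms(3) that unfolding row_def by (rule eliminate_column_has_sig)
  with Cons show ?case by simp
qed simp

text \<open>The third claim is what makes the reduction progress: of two rows with the same leading
  monomial, the one of larger signature loses it.\<close>

lemma gaussian_elimination:
  fixes st :: "('x, 'a::field) f45_state"
  assumes sig: "\<And>u k. (u, k) \<in> set F \<Longrightarrow> has_sig fs (poly_at st k) (sig_at st k)"
    and sorted: "sorted_wrt (\<lambda>(u, k) (v, l).
      sig_less (sig_mult u (sig_at st k)) (sig_mult v (sig_at st l))) F"
    and T: "sorted_wrt (\<lambda>s t. t \<prec> s) T"
    and keys: "\<And>u k. (u, k) \<in> set F \<Longrightarrow> Poly_Mapping.keys (mmult u (poly_at st k)) \<subseteq> set T"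
  shows "length (gaussian_elimination st F T) = length F"
    and "\<And>i. i < length F \<Longrightarrow>
      has_sig fs (gaussian_elimination st F T ! i)
        (sig_mult (fst (F ! i)) (sig_at st (snd (F ! i))))"
    and "\<And>a b. \<lbrakk>a < b; b < length F; poly_at st (snd (F ! a)) \<noteq> 0\<rbrakk>
      \<Longrightarrow> Poly_Mapping.lookup (gaussian_elimination st F T ! b)
            (fst (F ! a) + LM (poly_at st (snd (F ! a)))) = 0"
proof -
  define A where "A = (\<lambda>i j.
    Poly_Mapping.lookup (mmult (fst (F ! i)) (poly_at st (snd (F ! i)))) (T ! j))"
  define A' where "A' = fold (eliminate_column (length F)) [0..<length T] A"
  define row where "row = (\<lambda>A (i :: nat). \<Sum>j<length T. Poly_Mapping.single (T ! j) (A i j :: 'a))"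
  have ge: "gaussian_elimination st F T = map (row A') [0..<length F]"
    by (simp add: gaussian_elimination_def Let_def A_def A'_def row_def)
  then show "length (gaussian_elimination st F T) = length F" by simp
  have dist: "distinct T"
  proof -
    have "distinct (map (\<lambda>t. t) T)"
      unfolding distinct_map using T
      by (auto simp: distinct_conv_nth sorted_wrt_iff_nth_less neq_iff)
        (metis mo.less_irrefl)+
    then show ?thesis by simp
  qed
  have nth: "(fst (F ! i), snd (F ! i)) \<in> set F" if "i < length F" for i
    using that by simp
  have row_A: "row A i = mmult (fst (F ! i)) (poly_at st (snd (F ! i)))" if "i < length F" for i
    unfolding row_def A_def using keys[OF nth[OF that]] dist by (simp add: sum_single_nth_lookup)
  have "has_sig fs (row A' i) (sig_mult (fst (F ! i)) (sig_at st (snd (F ! i))))"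
    if "i < length F" for i
    unfolding A'_def row_def
  proof (rule fold_eliminate_column_has_sig[where M = "length F"])
    show "has_sig fs (\<Sum>j<length T. Poly_Mapping.single (T ! j) (A i j))
      (sig_mult (fst (F ! i)) (sig_at st (snd (F ! i))))" if "i < length F" for i
      using row_A[OF that] sig[OF nth[OF that]] by (simp add: row_def has_sig_mmult)
    show "sig_less (sig_mult (fst (F ! i)) (sig_at st (snd (F ! i))))
        (sig_mult (fst (F ! j)) (sig_at st (snd (F ! j))))" if "i < j" "j < length F" for i j
      using sorted that by (auto simp: sorted_wrt_iff_nth_less case_prod_beta)
  qed (rule that)
  then show "has_sig fs (gaussian_elimination st F T ! i)
      (sig_mult (fst (F ! i)) (sig_at st (snd (F ! i))))" if "i < length F" for i
    using that by (simp add: ge)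
  show "Poly_Mapping.lookup (gaussian_elimination st F T ! b)
      (fst (F ! a) + LM (poly_at st (snd (F ! a)))) = 0"
    if ab: "a < b" "b < length F" "poly_at st (snd (F ! a)) \<noteq> 0" for a b
  proof -
    define q where "q = mmult (fst (F ! a)) (poly_at st (snd (F ! a)))"
    have q: "q \<noteq> 0" "LM q = fst (F ! a) + LM (poly_at st (snd (F ! a)))"
      using ab(3) by (simp_all add: q_def LM_mmult) (simp add: mmult_def single_times_eq_0_iff)
    have qT: "Poly_Mapping.keys q \<subseteq> set T"
      unfolding q_def using ab by (intro keys nth) simp
    then obtain c where c: "c < length T" "T ! c = LM q"
      using LM_in_keys[OF q(1)] by (metis in_set_conv_nth subsetD)
    have "A a c \<noteq> 0"
      using LM_in_keys[OF q(1)] by (simp add: A_def q_def[symmetric] c(2) in_keys_iff)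
    \<comment> \<open>\<open>T\<close> is decreasing, so the columns before \<open>c\<close> belong
      to monomials larger than \<open>LM q\<close>: the first nonzero entry of row \<open>a\<close>
      is in column \<open>c\<close>.\<close>
    moreover have "A a j = 0" if "j < c" for j
    proof -
      have "LM q \<prec> T ! j"
        using T that c by (metis sorted_wrt_iff_nth_less)
      then have "T ! j \<notin> Poly_Mapping.keys q"
        using LM_ge mo.not_le by blast
      then show ?thesis by (simp add: A_def q_def[symmetric] in_keys_iff)
    qed
    ultimately have "A' b c = 0"
      unfolding A'_def using ab c by (intro fold_eliminate_column_zero) auto
    then have "Poly_Mapping.lookup (row A' b) (T ! c) = 0"
      unfolding row_def using c(1) dist by (simp add: lookup_sum_single_nth)
    then show ?thesis using ab by (simp add: ge c(2) q(2))
  qed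
qed

end


section \<open>Rules and rewritability\<close>

lemma find_append: "find P (xs @ ys) = (case find P xs of None \<Rightarrow> find P ys | Some x \<Rightarrow> Some x)"
  by (induction xs) auto

lemma sig_mult_add: "sig_mult (u + v) \<sigma> = sig_mult u (sig_mult v \<sigma>)"
  by (simp add: sig_mult_def add.assoc)

lemma snd_sig_mult [simp]: "snd (sig_mult u \<sigma>) = snd \<sigma>"
  by (simp add: sig_mult_def)

lemma fst_sig_mult [simp]: "fst (sig_mult u \<sigma>) = u + fst \<sigma>"
  by (simp add: sig_mult_def)

text \<open>What survives from a state to all later ones. Rewritability is required in one direction
  only, since new rules may make more multiples rewritable.\<close>

definition extends :: "('x, 'a::zero) f45_state \<Rightarrow> ('x, 'a) f45_state \<Rightarrow> bool"
  where "extends st st' \<longleftrightarrow>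
    (\<exists>xs. labelled st' = labelled st @ xs) \<and>
    (\<forall>u. \<forall>k<length (labelled st). rewritable st u k \<longrightarrow> rewritable st' u k)"

lemma extends_refl [simp]: "extends st st"
  by (simp add: extends_def)

lemma extends_length: "extends st st' \<Longrightarrow> length (labelled st) \<le> length (labelled st')"
  by (auto simp: extends_def)

lemma extends_sig_at: "extends st st' \<Longrightarrow> k < length (labelled st) \<Longrightarrow> sig_at st' k = sig_at st k"
  by (auto simp: extends_def sig_at_def nth_append)

lemma extends_poly_at: "extends st st' \<Longrightarrow> k < length (labelled st) \<Longrightarrow> poly_at st' k = poly_at st k"
  by (auto simp: extends_def poly_at_def nth_append)

lemma extends_rewritable:
  "extends st st' \<Longrightarrow> k < length (labelled st) \<Longrightarrow> rewritable st u k \<Longrightarrow> rewritable st' u k"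
  by (auto simp: extends_def)

lemma extends_trans:
  assumes "extends st st'" "extends st' st''"
  shows "extends st st''"
proof -
  have "rewritable st'' u k" if "k < length (labelled st)" "rewritable st u k" for u k
    using that assms extends_length[OF assms(1)] by (meson extends_rewritable less_le_trans)
  moreover have "\<exists>xs. labelled st'' = labelled st @ xs"
    using assms unfolding extends_def by (metis append.assoc)
  ultimately show ?thesis by (simp add: extends_def)
qed

context monomial_ordering
begin

lemma dropWhile_le_sorted:
  "sorted_wrt (\<lambda>e e'. fst e \<preceq> fst e') xs \<Longrightarrow> e \<in> set (dropWhile (\<lambda>(s, j). s \<preceq> t) xs)
    \<Longrightarrow> t \<prec> fst e"
proof (induction xs)
  case (Cons a xs)
  show ?case
  proof (cases "fst a \<preceq> t")
    case True
    then show ?thesis using Cons by (simp add: case_prod_beta)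
  next
    case False
    then have "t \<prec> fst a" by (simp add: mo.not_le)
    moreover have "fst a \<preceq> fst e"
      using Cons.prems False by (auto simp: case_prod_beta)
    ultimately show ?thesis by (rule mo.less_le_trans)
  qed
qed simp

text \<open>The last two conjuncts give each position exactly one rule, so that a rule list can be
  split at the rule of a position, as in \<open>rewritable_iff_split\<close>.\<close>

definition wf_state :: "('x, 'a::field) mpoly list \<Rightarrow> ('x, 'a) f45_state \<Rightarrow> bool"
  where "wf_state fs st \<longleftrightarrow>
    (\<forall>k<length (labelled st). has_sig fs (poly_at st k) (sig_at st k)) \<and>
    (\<forall>i. sorted_wrt (\<lambda>e e'. fst e \<preceq> fst e') (rules st i)) \<and>
    (\<forall>i. distinct (map snd (rules st i))) \<and>
    (\<forall>i t k. (t, k) \<in> set (rules st i) \<longleftrightarrow> k < length (labelled st) \<and> sig_at st k = (t, i))"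

lemma wf_state_has_sig:
  "wf_state fs st \<Longrightarrow> k < length (labelled st) \<Longrightarrow> has_sig fs (poly_at st k) (sig_at st k)"
  by (simp add: wf_state_def)

lemma wf_state_mem_rules:
  "wf_state fs st \<Longrightarrow>
    (t, k) \<in> set (rules st i) \<longleftrightarrow> k < length (labelled st) \<and> sig_at st k = (t, i)"
  by (simp add: wf_state_def)

lemma wf_state_split_rules:
  assumes "wf_state fs st" "k < length (labelled st)"
  obtains xs ys where "rules st (snd (sig_at st k)) = xs @ (fst (sig_at st k), k) # ys"
proof -
  have "(fst (sig_at st k), k) \<in> set (rules st (snd (sig_at st k)))"
    using assms by (simp add: wf_state_mem_rules)
  then show thesis using that by (meson split_list)
qed

text \<open>The own rule of \<open>k\<close> matches every multiple of \<open>k\<close>, so the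
  search from the end stops there at the latest. A match found earlier lies in \<open>ys\<close> and
  names another position, because positions are distinct.\<close>

lemma rewritable_iff_split:
  assumes "wf_state fs st" "rules st (snd (sig_at st k)) = xs @ (fst (sig_at st k), k) # ys"
  shows "rewritable st u k \<longleftrightarrow> (\<exists>e\<in>set ys. mdvd (fst e) (u + fst (sig_at st k)))"
proof -
  define P where "P = (\<lambda>(v, j :: nat). mdvd v (u + fst (sig_at st k)))"
  have rew: "rewritable st u k \<longleftrightarrow> (case find P (rev (rules st (snd (sig_at st k)))) of
      None \<Rightarrow> False | Some (v, j) \<Rightarrow> j \<noteq> k)"
    by (simp add: rewritable_def P_def case_prod_beta)
  have P: "P (fst (sig_at st k), k)" by (simp add: P_def)
  have "distinct (map snd (xs @ (fst (sig_at st k), k) # ys))"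
    using assms by (metis wf_state_def)
  then have notin: "k \<notin> snd ` set ys" by simp
  show ?thesis
  proof (cases "find P (rev ys)")
    case None
    then have "\<not> P e" if "e \<in> set ys" for e
      using that unfolding find_None_iff by (metis set_rev)
    then show ?thesis
      using None P by (auto simp: rew assms(2) find_append P_def case_prod_beta)
  next
    case (Some e)
    then have "e \<in> set ys" "P e"
      by (auto simp: find_Some_iff) (metis length_rev nth_mem set_rev)
    then show ?thesis
      using Some notin by (force simp: rew assms(2) find_append P_def case_prod_beta)
  qed
qed

lemma rewritable_mult:
  assumes "wf_state fs st" "k < length (labelled st)" "rewritable st u k"
  shows "rewritable st (z + u) k"
proof -
  obtain xs ys where split: "rules st (snd (sig_at st k)) = xs @ (fst (sig_at st k), k) # ys"
    using assms(1,2) by (rule wf_state_split_rules)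
  show ?thesis
    using assms(3) unfolding rewritable_iff_split[OF assms(1) split]
    by (auto simp: add.assoc intro: mdvd_add_mono)
qed

text \<open>The search depends only on the signature of the multiple, so it finds the same position
  for both; not being rewritable means being that position.\<close>

lemma not_rewritable_unique:
  assumes "wf_state fs st" "k < length (labelled st)" "l < length (labelled st)"
    and "\<not> rewritable st u k" "\<not> rewritable st v l"
    and eq: "sig_mult u (sig_at st k) = sig_mult v (sig_at st l)"
  shows "k = l \<and> u = v"
proof -
  define i where "i = snd (sig_at st k)"
  define t where "t = u + fst (sig_at st k)"
  have i: "snd (sig_at st l) = i" and t: "v + fst (sig_at st l) = t"
    using eq by (simp_all add: sig_mult_def i_def t_def)
  define r where "r = find (\<lambda>(v, j). mdvd v t) (rev (rules st i))"
  have "(fst (sig_at st k), k) \<in> set (rules st i)"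
    using assms(1,2) by (simp add: wf_state_mem_rules i_def)
  moreover have "mdvd (fst (sig_at st k)) t" by (simp add: t_def)
  ultimately have "r \<noteq> None"
    unfolding r_def find_None_iff by auto
  then obtain w j where r: "r = Some (w, j)" by auto
  have "rewritable st u k \<longleftrightarrow> j \<noteq> k"
    using r by (simp add: rewritable_def r_def t_def i_def case_prod_beta)
  moreover have "rewritable st v l \<longleftrightarrow> j \<noteq> l"
    using r by (simp add: rewritable_def r_def t i case_prod_beta)
  ultimately have "k = l" using assms(4,5) by simp
  then show ?thesis using eq by (simp add: sig_mult_def)
qed

text \<open>The rule of \<open>k0\<close> has monomial 1 and matches every signature of index
  \<open>i\<close>, so the search always finds some position, the rewriter of
  \<open>(t, i)\<close>.\<close>

lemma rewriter_exists:
  assumes "wf_state fs st" "k0 < length (labelled st)" "sig_at st k0 = (0, i)"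
  obtains u k where "k < length (labelled st)" "sig_mult u (sig_at st k) = (t, i)"
    "\<not> rewritable st u k"
proof -
  define r where "r = find (\<lambda>(v, j). mdvd v t) (rev (rules st i))"
  have "(0, k0) \<in> set (rules st i)"
    using assms by (simp add: wf_state_mem_rules)
  then have "r \<noteq> None"
    unfolding r_def find_None_iff by force
  then obtain v k where r: "r = Some (v, k)" by auto
  then have "(v, k) \<in> set (rules st i)" "mdvd v t"
    unfolding r_def by (auto simp: find_Some_iff) (metis length_rev nth_mem set_rev)
  then have k: "k < length (labelled st)" "sig_at st k = (v, i)" "(t - v) + v = t"
    using assms(1) by (simp_all add: wf_state_mem_rules mdvd_diff)
  have "\<not> rewritable st (t - v) k"
    using r by (simp add: rewritable_def r_def k)
  with k show thesis by (intro that[of k "t - v"]) (simp_all add: sig_mult_def)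
qed

section \<open>Appending a labelled polynomial together with its rule\<close>

lemma labelled_append_labelled [simp]:
  "labelled (append_labelled \<sigma> p st) = labelled st @ [(\<sigma>, p)]"
  by (simp add: append_labelled_def add_rule_def Let_def split: prod.split)

lemma rules_append_labelled:
  "rules (append_labelled \<sigma> p st) = (rules st)(snd \<sigma> :=
    takeWhile (\<lambda>(s, j). s \<preceq> fst \<sigma>) (rules st (snd \<sigma>)) @ [(fst \<sigma>, length (labelled st))] @
    dropWhile (\<lambda>(s, j). s \<preceq> fst \<sigma>) (rules st (snd \<sigma>)))"
  by (simp add: append_labelled_def add_rule_def Let_def split: prod.split)

lemma sig_at_append_labelled [simp]:
  "sig_at (append_labelled \<sigma> p st) (length (labelled st)) = \<sigma>"
  "k < length (labelled st) \<Longrightarrow> sig_at (append_labelled \<sigma> p st) k = sig_at st k"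
  by (simp_all add: sig_at_def nth_append)

lemma poly_at_append_labelled [simp]:
  "poly_at (append_labelled \<sigma> p st) (length (labelled st)) = p"
  "k < length (labelled st) \<Longrightarrow> poly_at (append_labelled \<sigma> p st) k = poly_at st k"
  by (simp_all add: poly_at_def nth_append)

lemma wf_state_append_labelled:
  assumes wf: "wf_state fs st" and p: "has_sig fs p \<sigma>"
  shows "wf_state fs (append_labelled \<sigma> p st)"
proof -
  let ?st = "append_labelled \<sigma> p st"
  define n where "n = length (labelled st)"
  define A where "A i = takeWhile (\<lambda>(s, j). s \<preceq> fst \<sigma>) (rules st i)" for i
  define B where "B i = dropWhile (\<lambda>(s, j). s \<preceq> fst \<sigma>) (rules st i)" for i
  have AB: "rules st i = A i @ B i" for i by (simp add: A_def B_def)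
  have rules: "rules ?st i = (if i = snd \<sigma> then A i @ (fst \<sigma>, n) # B i else rules st i)" for i
    by (simp add: rules_append_labelled A_def B_def n_def)
  have sorted: "sorted_wrt (\<lambda>e e'. fst e \<preceq> fst e') (rules st i)"
    and dist: "distinct (map snd (rules st i))" for i
    using wf by (auto simp: wf_state_def)
  have A: "fst e \<preceq> fst \<sigma>" if "e \<in> set (A i)" for e i
    using that unfolding A_def by (auto dest: set_takeWhileD)
  have B: "fst \<sigma> \<preceq> fst e" if "e \<in> set (B i)" for e i
    using dropWhile_le_sorted[OF sorted] that mo.less_imp_le unfolding B_def by blast
  have mem: "k < n \<and> sig_at st k = (t, i)" if "(t, k) \<in> set (rules st i)" for t k i
    using that wf_state_mem_rules[OF wf] by (simp add: n_def)
  have "has_sig fs (poly_at ?st k) (sig_at ?st k)" if "k < length (labelled ?st)" for k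
    using that wf_state_has_sig[OF wf] p
    by (cases "k = length (labelled st)") auto
  moreover have "sorted_wrt (\<lambda>e e'. fst e \<preceq> fst e') (rules ?st i)" for i
    using sorted[of i] A[of _ i] B[of _ i] by (auto simp: rules AB sorted_wrt_append)
  moreover have "distinct (map snd (rules ?st i))" for i
  proof -
    have "n \<notin> snd ` set (rules st i)" using mem by force
    then show ?thesis using dist[of i] by (auto simp: rules AB)
  qed
  moreover have "(t, k) \<in> set (rules ?st i) \<longleftrightarrow>
      k < length (labelled ?st) \<and> sig_at ?st k = (t, i)" for t k i
  proof -
    have "(t, k) \<in> set (rules ?st i) \<longleftrightarrow>
        (t, k) \<in> set (rules st i) \<or> (k = n \<and> \<sigma> = (t, i))"
      unfolding rules AB prod_eq_iff by auto
    also have "\<dots> \<longleftrightarrow> k < length (labelled ?st) \<and> sig_at ?st k = (t, i)"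
      unfolding wf_state_mem_rules[OF wf]
      by (cases "k = n") (auto simp: n_def less_Suc_eq)
    finally show ?thesis .
  qed
  ultimately show ?thesis unfolding wf_state_def by blast
qed

text \<open>A new rule is placed behind all rules whose monomial is at most its own. Hence what was
  behind the rule of \<open>k\<close> stays there, and the new rule joins it if its monomial is not
  smaller; equality must be included, as the cofactor of a multiple may be 1.\<close>

lemma append_labelled_later_rules:
  assumes wf: "wf_state fs st" and p: "has_sig fs p \<sigma>" and k: "k < length (labelled st)"
    and split: "rules st (snd (sig_at st k)) = xs @ (fst (sig_at st k), k) # ys"
  obtains xs' ys' where
    "rules (append_labelled \<sigma> p st) (snd (sig_at st k)) = xs' @ (fst (sig_at st k), k) # ys'"
    "set ys \<subseteq> set ys'"
    "snd \<sigma> = snd (sig_at st k) \<Longrightarrow> fst (sig_at st k) \<preceq> fst \<sigma> \<Longrightarrow> \<exists>j. (fst \<sigma>, j) \<in> set ys'"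
proof (cases "snd \<sigma> = snd (sig_at st k)")
  case False
  then show thesis by (intro that[of xs ys]) (simp_all add: rules_append_labelled split)
next
  case True
  let ?t = "fst (sig_at st k)"
  let ?P = "\<lambda>(s, j :: nat). s \<preceq> fst \<sigma>"
  define e where "e = (fst \<sigma>, length (labelled st))"
  have new: "rules (append_labelled \<sigma> p st) (snd (sig_at st k))
      = takeWhile ?P (xs @ (?t, k) # ys) @ e # dropWhile ?P (xs @ (?t, k) # ys)"
    using True by (simp add: rules_append_labelled split e_def)
  have sorted: "sorted_wrt (\<lambda>e e'. fst e \<preceq> fst e') (xs @ (?t, k) # ys)"
    using wf unfolding wf_state_def split[symmetric] by blast
  show thesis
  proof (cases "?t \<preceq> fst \<sigma>")
    case le: True
    have "?P d" if "d \<in> set xs" for d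
    proof -
      have "fst d \<preceq> ?t" using that sorted by (simp add: sorted_wrt_append)
      then show ?thesis using le mo.order_trans by (auto simp: case_prod_beta)
    qed
    then have "rules (append_labelled \<sigma> p st) (snd (sig_at st k))
        = xs @ (?t, k) # (takeWhile ?P ys @ e # dropWhile ?P ys)"
      unfolding new using le by (simp add: takeWhile_append2 dropWhile_append2)
    moreover have "set ys \<subseteq> set (takeWhile ?P ys @ e # dropWhile ?P ys)"
      by (metis Un_iff list.set_intros(2) set_append subsetI takeWhile_dropWhile_id)
    moreover have "\<exists>j. (fst \<sigma>, j) \<in> set (takeWhile ?P ys @ e # dropWhile ?P ys)"
      by (auto simp: e_def)
    ultimately show thesis by (rule that)
  next
    case not_le: False
    show thesis
    proof (rule that)
      have "rules (append_labelled \<sigma> p st) (snd (sig_at st k))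
          = (takeWhile ?P xs @ e # dropWhile ?P xs) @ (?t, k) # ys"
      proof (cases "\<forall>d\<in>set xs. ?P d")
        case True
        then show ?thesis
          unfolding new using not_le
          by (simp add: takeWhile_append2 dropWhile_append2 takeWhile_eq_all_conv[THEN iffD2])
      next
        case False
        then obtain d where "d \<in> set xs" "\<not> ?P d" by blast
        then show ?thesis
          unfolding new by (simp add: takeWhile_append1 dropWhile_append1)
      qed
      then show "rules (append_labelled \<sigma> p st) (snd (sig_at st k))
          = (takeWhile ?P xs @ e # dropWhile ?P xs) @ (?t, k) # ys" .
    qed (use not_le in auto)
  qed
qed

lemma extends_append_labelled:
  assumes wf: "wf_state fs st" and p: "has_sig fs p \<sigma>"
  shows "extends st (append_labelled \<sigma> p st)"
  unfolding extends_def
proof (intro conjI allI impI)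
  fix u k assume k: "k < length (labelled st)" and rew: "rewritable st u k"
  obtain xs ys where split: "rules st (snd (sig_at st k)) = xs @ (fst (sig_at st k), k) # ys"
    using wf k by (rule wf_state_split_rules)
  obtain xs' ys' where split':
    "rules (append_labelled \<sigma> p st) (snd (sig_at st k)) = xs' @ (fst (sig_at st k), k) # ys'"
    "set ys \<subseteq> set ys'"
    using wf p k split by (rule append_labelled_later_rules)
  have sig: "sig_at (append_labelled \<sigma> p st) k = sig_at st k"
    using k by simp
  show "rewritable (append_labelled \<sigma> p st) u k"
    using rew split' sig rewritable_iff_split[OF wf split]
      rewritable_iff_split[OF wf_state_append_labelled[OF wf p], of k xs' ys' u]
    by auto
qed simp

text \<open>The new rule has exactly the monomial tested for \<open>(u, k)\<close> and stands behind
  the rule of \<open>k\<close>. So a multiple that the reduction replaces is rejected from then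
  on.\<close>

lemma rewritable_append_labelled:
  assumes wf: "wf_state fs st" and p: "has_sig fs p (sig_mult u (sig_at st k))"
    and k: "k < length (labelled st)"
  shows "rewritable (append_labelled (sig_mult u (sig_at st k)) p st) u k"
proof -
  let ?\<sigma> = "sig_mult u (sig_at st k)"
  obtain xs ys where split: "rules st (snd (sig_at st k)) = xs @ (fst (sig_at st k), k) # ys"
    using wf k by (rule wf_state_split_rules)
  obtain xs' ys' where split':
    "rules (append_labelled ?\<sigma> p st) (snd (sig_at st k)) = xs' @ (fst (sig_at st k), k) # ys'"
    "snd ?\<sigma> = snd (sig_at st k) \<Longrightarrow> fst (sig_at st k) \<preceq> fst ?\<sigma> \<Longrightarrow> \<exists>j. (fst ?\<sigma>, j) \<in> set ys'"
    using append_labelled_later_rules[OF wf p k split] by metis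
  obtain j where "(fst ?\<sigma>, j) \<in> set ys'"
    using split'(2) le_multiple by auto
  moreover have sig: "sig_at (append_labelled ?\<sigma> p st) k = sig_at st k"
    using k by simp
  ultimately show ?thesis
    using split' rewritable_iff_split[OF wf_state_append_labelled[OF wf p], of k xs' ys' u]
    by (auto intro!: bexI[of _ "(fst ?\<sigma>, j)"])
qed


section \<open>Good multiples and critical pairs\<close>

text \<open>The multiples \<open>(u, k)\<close> that pass the tests of Update, SPolynomials and FindReductor.\<close>

definition good :: "('x, 'a::zero) f45_state \<Rightarrow> nat set \<Rightarrow> 'x monomial \<Rightarrow> nat \<Rightarrow> bool"
  where "good st G u k \<longleftrightarrow>
    \<not> top_reducible st (u + fst (sig_at st k)) {g \<in> G. idx_at st g < idx_at st k} \<and>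
    \<not> rewritable st u k"

text \<open>Both tests look for divisors of the monomial of the signature, so a rejection for
  \<open>u\<close> is a rejection for \<open>z + u\<close>.\<close>

lemma good_divisor:
  assumes "good st G (z + u) k" "wf_state fs st" "k < length (labelled st)"
  shows "good st G u k"
proof -
  have "mdvd s (z + u + fst (sig_at st k))" if "mdvd s (u + fst (sig_at st k))" for s
    using mdvd_add_mono[OF that, of z] by (simp add: add.assoc)
  then show ?thesis
    using assms(1) rewritable_mult[OF assms(2,3)]
    unfolding good_def top_reducible_def by blast
qed

text \<open>A larger \<open>G\<close> and more rules only give the two tests more grounds for
  rejection. So a pair discarded once need not be reconsidered.\<close>

lemma good_antimono:
  assumes good: "good st' G' u k" and ext: "extends st st'" and k: "k < length (labelled st)"
    and G: "G \<subseteq> G'" "G \<subseteq> {..<length (labelled st)}"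
  shows "good st G u k"
proof -
  have sig: "sig_at st' l = sig_at st l" and poly: "poly_at st' l = poly_at st l"
    if "l < length (labelled st)" for l
    using extends_sig_at[OF ext that] extends_poly_at[OF ext that] by auto
  have "\<not> rewritable st u k"
    using good extends_rewritable[OF ext k] by (auto simp: good_def)
  moreover have "\<not> top_reducible st (u + fst (sig_at st k)) {g \<in> G. idx_at st g < idx_at st k}"
  proof
    assume "top_reducible st (u + fst (sig_at st k)) {g \<in> G. idx_at st g < idx_at st k}"
    then obtain g where g: "g \<in> G" "idx_at st g < idx_at st k"
      "mdvd (LM (poly_at st g)) (u + fst (sig_at st k))"
      by (auto simp: top_reducible_def)
    then have "g \<in> G'" "g < length (labelled st)" using G by auto
    with g have "top_reducible st' (u + fst (sig_at st' k)) {g \<in> G'. idx_at st' g < idx_at st' k}"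
      unfolding top_reducible_def
      by (intro bexI[of _ g]) (simp_all add: idx_at_def sig poly k)
    with good show False by (simp add: good_def)
  qed
  ultimately show ?thesis by (simp add: good_def)
qed

text \<open>Only the order with the larger signature first is required, since Update returns pairs
  in this order. In a well-formed state, good multiples of distinct positions never have equal
  signatures, by \<open>not_rewritable_unique\<close>.\<close>

definition pairs_ok :: "('x, 'a::zero) f45_state \<Rightarrow> nat set \<Rightarrow> 'x critpair set \<Rightarrow> bool"
  where "pairs_ok st G P \<longleftrightarrow> (\<forall>k\<in>G. \<forall>l\<in>G.
    let t = mlcm (LM (poly_at st k)) (LM (poly_at st l));
        u = t - LM (poly_at st k); v = t - LM (poly_at st l)
    in k \<noteq> l \<longrightarrow> good st G u k \<longrightarrow> good st G v l \<longrightarrow>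
       sig_less (sig_mult v (sig_at st l)) (sig_mult u (sig_at st k)) \<longrightarrow>
       (t, u, k, v, l) \<in> P)"

lemma pairs_okD:
  assumes "pairs_ok st G P" "k \<in> G" "l \<in> G" "k \<noteq> l"
    and "good st G (mlcm (LM (poly_at st k)) (LM (poly_at st l)) - LM (poly_at st k)) k"
    and "good st G (mlcm (LM (poly_at st k)) (LM (poly_at st l)) - LM (poly_at st l)) l"
    and "sig_less
      (sig_mult (mlcm (LM (poly_at st k)) (LM (poly_at st l)) - LM (poly_at st l)) (sig_at st l))
      (sig_mult (mlcm (LM (poly_at st k)) (LM (poly_at st l)) - LM (poly_at st k)) (sig_at st k))"
  shows "(mlcm (LM (poly_at st k)) (LM (poly_at st l)),
      mlcm (LM (poly_at st k)) (LM (poly_at st l)) - LM (poly_at st k), k,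
      mlcm (LM (poly_at st k)) (LM (poly_at st l)) - LM (poly_at st l), l) \<in> P"
  using assms unfolding pairs_ok_def Let_def by blast

lemma update_good:
  fixes st :: "('x, 'a::zero) f45_state"
  defines "t \<equiv> \<lambda>k l. mlcm (LM (poly_at st k)) (LM (poly_at st l))"
  assumes "good st G (t k l - LM (poly_at st k)) k" "good st G (t k l - LM (poly_at st l)) l"
  shows "update st G k l =
    (if sig_less (sig_mult (t k l - LM (poly_at st k)) (sig_at st k))
         (sig_mult (t k l - LM (poly_at st l)) (sig_at st l))
     then Some (t k l, t k l - LM (poly_at st l), l, t k l - LM (poly_at st k), k)
     else Some (t k l, t k l - LM (poly_at st k), k, t k l - LM (poly_at st l), l))"
  using assms(2,3) by (simp add: update_def Let_def good_def t_def)

text \<open>Update tests the multiples against \<open>G\<close> without \<open>i\<close>. By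
  \<open>good_antimono\<close>, those good for \<open>insert i G\<close> pass, so all required pairs
  with \<open>i\<close> are created; the others are in \<open>P\<close> already.\<close>

lemma pairs_ok_enter:
  fixes st :: "('x, 'a::zero) f45_state"
  assumes ok: "pairs_ok st G P" and G: "insert i G \<subseteq> {..<length (labelled st)}"
  shows "case enter st i (G, P) of (G', P') \<Rightarrow> pairs_ok st G' P'"
proof -
  define P' where "P' = P \<union> {p. \<exists>j\<in>G. update st G i j = Some p}"
  define t where "t = (\<lambda>k l. mlcm (LM (poly_at st k)) (LM (poly_at st l)))"
  have t_commute: "t k l = t l k" for k l by (simp add: t_def mlcm_commute)
  have anti: "good st G u k" if "good st (insert i G) u k" "k \<in> insert i G" for u k
    using that(1) by (rule good_antimono) (use that(2) G in auto)
  have "(t k l, t k l - LM (poly_at st k), k, t k l - LM (poly_at st l), l) \<in> P'"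
    if kl: "k \<in> insert i G" "l \<in> insert i G" "k \<noteq> l"
      and good: "good st (insert i G) (t k l - LM (poly_at st k)) k"
        "good st (insert i G) (t k l - LM (poly_at st l)) l"
      and less: "sig_less (sig_mult (t k l - LM (poly_at st l)) (sig_at st l))
        (sig_mult (t k l - LM (poly_at st k)) (sig_at st k))"
    for k l
  proof -
    have good': "good st G (t k l - LM (poly_at st k)) k" "good st G (t k l - LM (poly_at st l)) l"
      using anti good kl by auto
    consider "k \<in> G" "l \<in> G" | "k = i" "l \<in> G" | "k \<in> G" "l = i" using kl by blast
    then show ?thesis
    proof cases
      case 1
      then show ?thesis
        using pairs_okD[OF ok 1 kl(3)] good' less by (simp add: P'_def t_def)
    next
      case 2
      have "\<not> sig_less (sig_mult (t k l - LM (poly_at st k)) (sig_at st k))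
          (sig_mult (t k l - LM (poly_at st l)) (sig_at st l))"
        using less sig_less_trans sig_less_irrefl by blast
      then have "update st G k l
          = Some (t k l, t k l - LM (poly_at st k), k, t k l - LM (poly_at st l), l)"
        using update_good[of st G k l] good' by (simp add: t_def)
      then show ?thesis using 2 by (auto simp: P'_def)
    next
      case 3
      have "update st G l k
          = Some (t k l, t k l - LM (poly_at st k), k, t k l - LM (poly_at st l), l)"
        using update_good[of st G l k] good' less t_commute[of k l] by (simp add: t_def)
      then show ?thesis using 3 by (auto simp: P'_def)
    qed
  qed
  then have "pairs_ok st (insert i G) P'"
    unfolding pairs_ok_def Let_def t_def by blast
  then show ?thesis by (simp add: enter_def P'_def)
qed


section \<open>Symbolic preprocessing and reduction\<close>

lemma find_reductor_None:
  assumes "find_reductor st \<mu> ks F = None" "k \<in> set ks" "u + LM (poly_at st k) = \<mu>"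
    and "good st (set ks) u k"
  shows "(u, k) \<in> set F"
proof (rule ccontr)
  assume "(u, k) \<notin> set F"
  moreover have "\<mu> - LM (poly_at st k) = u" "mdvd (LM (poly_at st k)) \<mu>"
    by (simp_all flip: assms(3))
  ultimately show False
    using assms(1,2,4) by (auto simp: find_reductor_def find_None_iff good_def Let_def)
qed

lemma find_reductor_Some:
  assumes "find_reductor st \<mu> ks F = Some (u, k)"
  shows "k \<in> set ks" "u + LM (poly_at st k) = \<mu>" "good st (set ks) u k" "(u, k) \<notin> set F"
proof -
  obtain P where "find P ks = Some k" and u: "u = \<mu> - LM (poly_at st k)"
    and P: "P = (\<lambda>k. mdvd (LM (poly_at st k)) \<mu> \<and>
       (let u = \<mu> - LM (poly_at st k); t = fst (sig_at st k); i = idx_at st k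
        in (u, k) \<notin> set F \<and> \<not> top_reducible st (u + t) {g \<in> set ks. idx_at st g < i} \<and>
           \<not> rewritable st u k))"
    using assms unfolding find_reductor_def map_option_eq_Some by auto
  then have k: "k \<in> set ks" and Pk: "P k"
    by (auto simp: find_Some_iff)
  show "k \<in> set ks" by (rule k)
  show "u + LM (poly_at st k) = \<mu>" "good st (set ks) u k" "(u, k) \<notin> set F"
    using Pk unfolding P u good_def Let_def by (auto simp: mdvd_diff)
qed

text \<open>At the end \<open>M = Done\<close>, so every monomial of a row has become a column of
  the matrix. Rows stay distinct because FindReductor refuses multiples that are in
  \<open>F\<close>.\<close>

lemma symbolic_loop_rows:
  assumes "symbolic_loop st G F Done M F' Done'"
    and "\<forall>(u, k)\<in>set F. k \<in> G \<and> \<not> rewritable st u k \<and>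
      Poly_Mapping.keys (mmult u (poly_at st k)) \<subseteq> M" "distinct F"
  shows "(\<forall>(u, k)\<in>set F'. k \<in> G \<and> \<not> rewritable st u k \<and>
      Poly_Mapping.keys (mmult u (poly_at st k)) \<subseteq> Done') \<and> distinct F' \<and> set F \<subseteq> set F'"
  using assms
proof (induction rule: symbolic_loop.induct)
  case (reductor M Done \<mu> ks F t k F' Done')
  note found = find_reductor_Some[OF reductor.hyps(5)]
  have "distinct (F @ [(t, k)])" using found(4) reductor.prems(2) by simp
  moreover have "\<forall>(u, k')\<in>set (F @ [(t, k)]). k' \<in> G \<and> \<not> rewritable st u k' \<and>
      Poly_Mapping.keys (mmult u (poly_at st k'))
        \<subseteq> M \<union> Poly_Mapping.keys (mmult t (poly_at st k))"
    using found(1,3) reductor.prems(1) reductor.hyps(3) by (auto simp: good_def)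
  ultimately show ?case using reductor.IH by simp
qed auto

text \<open>FindReductor is called once per monomial, hence the assumption that at most
  \<open>x\<close> is missing from \<open>F\<close>. When the turn of \<open>t\<close> comes, a
  reductor found is a candidate outside \<open>F\<close>, thus \<open>x\<close>; if none is found,
  nothing was missing.\<close>

lemma symbolic_loop_complete:
  fixes st :: "('x, 'a::comm_ring_1) f45_state"
  defines "C \<equiv> \<lambda>t G. {(u, k). k \<in> G \<and> u + LM (poly_at st k) = t \<and> good st G u k}"
  assumes "symbolic_loop st G F Done M F' Done'"
    and "t \<in> M" "t \<in> Done \<longrightarrow> C t G \<subseteq> set F" "C t G \<subseteq> insert x (set F)"
  shows "C t G \<subseteq> set F'"
  using assms(2-)
proof (induction rule: symbolic_loop.induct)
  case (no_reductor M Done \<mu> ks F F' Done')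
  have "C \<mu> G \<subseteq> set F"
    using find_reductor_None[OF no_reductor.hyps(5)] no_reductor.hyps(3) unfolding C_def by auto
  then show ?case using no_reductor.IH no_reductor.prems by auto
next
  case (reductor M Done \<mu> ks F t' k F' Done')
  note found = find_reductor_Some[OF reductor.hyps(5)]
  have "(t', k) \<in> C \<mu> G" "(t', k) \<notin> set F"
    using found reductor.hyps(3) unfolding C_def by auto
  then have "t = \<mu> \<longrightarrow> C t G \<subseteq> set (F @ [(t', k)])"
    using reductor.prems(3) by auto
  moreover have "C t G \<subseteq> insert x (set (F @ [(t', k)]))" using reductor.prems(3) by auto
  ultimately show ?case using reductor.IH reductor.prems by auto
qed auto

text \<open>A row whose leading monomial changed is appended under the signature of the multiple it
  came from, so its rule makes that multiple rewritable. Rows that became 0 give a rule as well, but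
  do not enter the output set.\<close>

lemma reduction_step_fold:
  assumes "(st', H') = fold reduction_step xs (st, H)" and "wf_state fs st"
    and "\<And>u k q. ((u, k), q) \<in> set xs \<Longrightarrow>
      k < length (labelled st) \<and> has_sig fs q (sig_mult u (sig_at st k))"
  shows "wf_state fs st' \<and> extends st st' \<and>
    H' = H \<union> {k. length (labelled st) \<le> k \<and> k < length (labelled st') \<and> poly_at st' k \<noteq> 0} \<and>
    (\<forall>u k q. ((u, k), q) \<in> set xs \<longrightarrow> \<not> (q \<noteq> 0 \<and> LM q = u + LM (poly_at st k)) \<longrightarrow>
      rewritable st' u k)"
  using assms
proof (induction xs arbitrary: st H)
  case Nil
  then show ?case by auto
next
  case (Cons x xs)
  obtain u k q where x: "x = ((u, k), q)" by (metis prod.exhaust)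
  define st1 where "st1 = append_labelled (sig_mult u (sig_at st k)) q st"
  have k: "k < length (labelled st)" and q: "has_sig fs q (sig_mult u (sig_at st k))"
    using Cons.prems(3)[of u k q] by (auto simp: x)
  show ?case
  proof (cases "q \<noteq> 0 \<and> LM q = u + LM (poly_at st k)")
    case True
    then have "(st', H') = fold reduction_step xs (st, H)"
      using Cons.prems(1) by (simp add: x reduction_step_def)
    from Cons.IH[OF this Cons.prems(2) Cons.prems(3)] show ?thesis using True by (auto simp: x)
  next
    case False
    define H1 where "H1 = (if q \<noteq> 0 then insert (length (labelled st)) H else H)"
    have fold: "(st', H') = fold reduction_step xs (st1, H1)"
      using False Cons.prems(1) by (auto simp: x reduction_step_def st1_def H1_def Let_def)
    have wf1: "wf_state fs st1" and ext1: "extends st st1"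
      unfolding st1_def using Cons.prems(2) q
      by (rule wf_state_append_labelled, rule extends_append_labelled)
    have rew1: "rewritable st1 u k"
      unfolding st1_def using Cons.prems(2) q k by (rule rewritable_append_labelled)
    have len1: "length (labelled st1) = Suc (length (labelled st))" by (simp add: st1_def)
    have "wf_state fs st' \<and> extends st1 st' \<and>
      H' = H1 \<union> {k. length (labelled st1) \<le> k \<and> k < length (labelled st') \<and> poly_at st' k \<noteq> 0} \<and>
      (\<forall>u k q. ((u, k), q) \<in> set xs \<longrightarrow> \<not> (q \<noteq> 0 \<and> LM q = u + LM (poly_at st1 k)) \<longrightarrow>
        rewritable st' u k)"
      using fold wf1
    proof (rule Cons.IH)
      fix v l r assume "((v, l), r) \<in> set xs"
      then have "l < length (labelled st)" "has_sig fs r (sig_mult v (sig_at st l))"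
        using Cons.prems(3)[of v l r] by auto
      then show "l < length (labelled st1) \<and> has_sig fs r (sig_mult v (sig_at st1 l))"
        by (simp add: st1_def)
    qed
    then have wf': "wf_state fs st'" and ext': "extends st1 st'"
      and H': "H' = H1 \<union> {k. length (labelled st1) \<le> k \<and> k < length (labelled st') \<and> poly_at st' k \<noteq> 0}"
      and rew': "\<And>v l r. ((v, l), r) \<in> set xs \<Longrightarrow> \<not> (r \<noteq> 0 \<and> LM r = v + LM (poly_at st1 l)) \<Longrightarrow>
        rewritable st' v l"
      by blast+
    have "poly_at st' (length (labelled st)) = q"
      using extends_poly_at[OF ext', of "length (labelled st)"] by (simp add: st1_def)
    then have "H' = H \<union> {k. length (labelled st) \<le> k \<and> k < length (labelled st') \<and> poly_at st' k \<noteq> 0}"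
      using extends_length[OF ext'] unfolding H' H1_def len1
      by (auto simp: le_less Suc_le_eq)
    moreover have "rewritable st' v l"
      if mem: "((v, l), r) \<in> set (x # xs)" and nz: "\<not> (r \<noteq> 0 \<and> LM r = v + LM (poly_at st l))" for v l r
    proof (cases "((v, l), r) = x")
      case True
      then show ?thesis
        using extends_rewritable[OF ext', of k u] rew1 k len1 by (simp add: x)
    next
      case False
      then have "((v, l), r) \<in> set xs" using mem by auto
      moreover have "poly_at st1 l = poly_at st l"
        using Cons.prems(3)[OF mem] by (simp add: st1_def)
      ultimately show ?thesis using rew' nz by simp
    qed
    ultimately show ?thesis using wf' extends_trans[OF ext1 ext'] by blast
  qed
qed

text \<open>The positions that the main algorithm keeps in \<open>G\<close>.\<close>

definition live :: "('x, 'a::zero) f45_state \<Rightarrow> nat set"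
  where "live st = {k. k < length (labelled st) \<and> poly_at st k \<noteq> 0}"

text \<open>A pair of good multiples with the same leading monomial \<open>t\<close> of minimal degree is a critical
  pair: otherwise the gcd of the two cofactors could be cancelled.\<close>

lemma good_pair_mem:
  fixes st :: "('x, 'a::field) f45_state"
  assumes wf: "wf_state fs st" and G: "G \<subseteq> {..<length (labelled st)}" and ok: "pairs_ok st G P"
    and deg: "\<And>p. p \<in> P \<Longrightarrow> mdeg t \<le> pair_deg p"
    and kl: "k \<in> G" "l \<in> G" "k \<noteq> l"
    and t: "u + LM (poly_at st k) = t" "v + LM (poly_at st l) = t"
    and good: "good st G u k" "good st G v l"
    and less: "sig_less (sig_mult v (sig_at st l)) (sig_mult u (sig_at st k))"
  shows "(t, u, k, v, l) \<in> P"
proof -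
  define t' where "t' = mlcm (LM (poly_at st k)) (LM (poly_at st l))"
  have "mdvd t' t"
    unfolding t'_def using t mdvd_add(1) by (metis mlcm_least)
  then obtain z where z: "t = z + t'" by (auto simp: mdvd_def add.commute)
  have t': "(t' - LM (poly_at st k)) + LM (poly_at st k) = t'"
    "(t' - LM (poly_at st l)) + LM (poly_at st l) = t'"
    by (simp_all add: t'_def mdvd_mlcm mdvd_diff)
  have u: "u = z + (t' - LM (poly_at st k))" and v: "v = z + (t' - LM (poly_at st l))"
    using t z t' by (metis add.assoc add_right_cancel)+
  have "(t', t' - LM (poly_at st k), k, t' - LM (poly_at st l), l) \<in> P"
    unfolding t'_def
  proof (rule pairs_okD[OF ok kl])
    show "good st G (mlcm (LM (poly_at st k)) (LM (poly_at st l)) - LM (poly_at st k)) k"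
      using good_divisor[OF good(1)[unfolded u t'_def] wf] G kl(1) by auto
    show "good st G (mlcm (LM (poly_at st k)) (LM (poly_at st l)) - LM (poly_at st l)) l"
      using good_divisor[OF good(2)[unfolded v t'_def] wf] G kl(2) by auto
  qed (use less in \<open>simp add: u v sig_mult_add sig_less_mult t'_def\<close>)
  \<comment> \<open>The degree of \<open>t\<close> is at most that of the critical pair just found,
    whose monomial \<open>t'\<close> divides \<open>t\<close>; so the two are equal.\<close>
  moreover from deg[OF this] have "z = 0"
    by (simp add: pair_deg_def z mdeg_add mdeg_eq_0)
  ultimately show ?thesis by (simp add: u v z)
qed

definition positions_in :: "'x critpair set \<Rightarrow> nat set \<Rightarrow> bool"
  where "positions_in P G \<longleftrightarrow> (\<forall>t u k v l. (t, u, k, v, l) \<in> P \<longrightarrow> k \<in> G \<and> l \<in> G)"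

text \<open>The treated pairs may leave \<open>P\<close>: of two good multiples forming such a pair,
  the one of larger signature is rewritable afterwards.\<close>

lemma reduction_correct:
  fixes st :: "('x, 'a::field) f45_state"
  assumes wf: "wf_state fs st" and G: "G = live st" and ok: "pairs_ok st G P"
    and P: "positions_in P G"
    and deg: "\<And>p. p \<in> P \<Longrightarrow> d \<le> pair_deg p"
    and Pd: "Pd = {p \<in> P. pair_deg p = d}"
    and red: "reduction st (spolynomials st Pd) G st' H"
  shows "wf_state fs st'" "extends st st'" "live st' = G \<union> H" "pairs_ok st' G (P - Pd)"
proof -
  define S where "S = spolynomials st Pd"
  obtain F T F0 F1 Done where F0: "set F0 = S" "distinct F0"
    and loop: "symbolic_loop st G F0 {}
      (\<Union>(u, k)\<in>S. Poly_Mapping.keys (mmult u (poly_at st k))) F1 Done"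
    and F: "mset F = mset F1"
    and le: "sorted_wrt (\<lambda>(u, k) (v, l). sig_le (sig_mult u (sig_at st k)) (sig_mult v (sig_at st l))) F"
    and T: "set T = Done" "sorted_wrt (\<lambda>s t. t \<prec> s) T"
    and fold: "(st', H) = fold reduction_step (zip F (gaussian_elimination st F T)) (st, {})"
    using red unfolding reduction_def symbolic_preprocessing_def S_def by blast
  have G_sub: "G \<subseteq> {..<length (labelled st)}" by (auto simp: G live_def)
  have S: "k \<in> G \<and> \<not> rewritable st u k" if "(u, k) \<in> S" for u k
    using that P unfolding S_def spolynomials_def Pd positions_in_def by blast
  have set_F: "set F = set F1" using F by (metis set_mset_mset)
  have "(\<forall>(u, k)\<in>set F1. k \<in> G \<and> \<not> rewritable st u k \<and>
      Poly_Mapping.keys (mmult u (poly_at st k)) \<subseteq> Done) \<and> distinct F1 \<and> set F0 \<subseteq> set F1"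
    using loop by (rule symbolic_loop_rows) (use S F0 in auto)
  then have rows: "k \<in> G" "\<not> rewritable st u k"
      "Poly_Mapping.keys (mmult u (poly_at st k)) \<subseteq> set T" if "(u, k) \<in> set F" for u k
    using that by (auto simp: set_F T(1))
  have "distinct F"
    using \<open>_ \<and> distinct F1 \<and> _\<close> F by (metis distinct_count_atmost_1 set_F set_mset_mset)
  \<comment> \<open>The rows are sorted only weakly at first. Two rows of equal signature would be
    the same multiple, as neither is rewritable, but the rows are distinct.\<close>
  have less: "sorted_wrt (\<lambda>(u, k) (v, l).
      sig_less (sig_mult u (sig_at st k)) (sig_mult v (sig_at st l))) F"
    unfolding sorted_wrt_iff_nth_less
  proof (intro allI impI)
    fix i j assume ij: "i < j" "j < length F"
    obtain u k v l where uk: "F ! i = (u, k)" and vl: "F ! j = (v, l)" by (metis prod.exhaust)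
    have mem: "(u, k) \<in> set F" "(v, l) \<in> set F"
      using ij uk vl by (metis nth_mem order.strict_trans)+
    have "sig_mult u (sig_at st k) \<noteq> sig_mult v (sig_at st l)"
    proof
      assume "sig_mult u (sig_at st k) = sig_mult v (sig_at st l)"
      then have "k = l \<and> u = v"
        using rows[OF mem(1)] rows[OF mem(2)] wf G_sub
        by (intro not_rewritable_unique[of fs st]) auto
      then have "F ! i = F ! j" by (simp add: uk vl)
      then show False using \<open>distinct F\<close> ij by (simp add: nth_eq_iff_index_eq)
    qed
    moreover have "sig_le (sig_mult u (sig_at st k)) (sig_mult v (sig_at st l))"
      using le[unfolded sorted_wrt_iff_nth_less, rule_format, OF ij] by (simp add: uk vl)
    ultimately show "(case F ! i of (u, k) \<Rightarrow> \<lambda>(v, l).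
        sig_less (sig_mult u (sig_at st k)) (sig_mult v (sig_at st l))) (F ! j)"
      by (simp add: sig_le_def uk vl)
  qed
  have sig: "has_sig fs (poly_at st k) (sig_at st k)" if "(u, k) \<in> set F" for u k
    using rows(1)[OF that] G_sub wf by (auto intro: wf_state_has_sig)
  note ge = gaussian_elimination[where fs = fs, OF sig less T(2) rows(3)]
  have fold_hyp: "k < length (labelled st) \<and> has_sig fs q (sig_mult u (sig_at st k))"
    if mem: "((u, k), q) \<in> set (zip F (gaussian_elimination st F T))" for u k q
  proof -
    obtain i where i: "i < length F" "F ! i = (u, k)" "gaussian_elimination st F T ! i = q"
      using mem by (auto simp: in_set_zip)
    then have "(u, k) \<in> set F" by (metis nth_mem)
    then show ?thesis using rows(1) G_sub ge(2)[OF _ _ i(1)] i by auto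
  qed
  from reduction_step_fold[OF fold wf fold_hyp]
  show wf': "wf_state fs st'" and ext: "extends st st'" by blast+
  have H: "H = {k. length (labelled st) \<le> k \<and> k < length (labelled st') \<and> poly_at st' k \<noteq> 0}"
    and rew': "\<And>u k q. ((u, k), q) \<in> set (zip F (gaussian_elimination st F T)) \<Longrightarrow>
      \<not> (q \<noteq> 0 \<and> LM q = u + LM (poly_at st k)) \<Longrightarrow> rewritable st' u k"
    using reduction_step_fold[OF fold wf fold_hyp] by auto
  show "live st' = G \<union> H"
    using extends_length[OF ext] extends_poly_at[OF ext]
    unfolding G H live_def by (auto simp: not_le dest: less_le_trans)
  show "pairs_ok st' G (P - Pd)"
    unfolding pairs_ok_def Let_def
  proof (intro ballI impI)
    fix k l assume kl: "k \<in> G" "l \<in> G" "k \<noteq> l"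
    have same: "poly_at st' k = poly_at st k" "poly_at st' l = poly_at st l"
      "sig_at st' k = sig_at st k" "sig_at st' l = sig_at st l"
      using kl G_sub extends_poly_at[OF ext] extends_sig_at[OF ext] by auto
    define t where "t = mlcm (LM (poly_at st k)) (LM (poly_at st l))"
    define u where "u = t - LM (poly_at st k)"
    define v where "v = t - LM (poly_at st l)"
    have uv: "u + LM (poly_at st k) = t" "v + LM (poly_at st l) = t"
      by (simp_all add: u_def v_def t_def mdvd_mlcm mdvd_diff)
    assume good': "good st' G (mlcm (LM (poly_at st' k)) (LM (poly_at st' l)) - LM (poly_at st' k)) k"
        "good st' G (mlcm (LM (poly_at st' k)) (LM (poly_at st' l)) - LM (poly_at st' l)) l"
      and less': "sig_less
        (sig_mult (mlcm (LM (poly_at st' k)) (LM (poly_at st' l)) - LM (poly_at st' l)) (sig_at st' l))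
        (sig_mult (mlcm (LM (poly_at st' k)) (LM (poly_at st' l)) - LM (poly_at st' k)) (sig_at st' k))"
    note good' = good'[unfolded same, folded t_def, folded u_def v_def]
    note less' = less'[unfolded same, folded t_def, folded u_def v_def]
    have good: "good st G u k" "good st G v l"
      using good' ext kl G_sub by (blast intro: good_antimono)+
    have mem: "(t, u, k, v, l) \<in> P"
      using pairs_okD[OF ok kl] good less' by (simp add: t_def u_def v_def)
    have "(t, u, k, v, l) \<notin> Pd"
    proof
      assume Pd_mem: "(t, u, k, v, l) \<in> Pd"
      then have d: "d = mdeg t" by (simp add: Pd pair_deg_def)
      have uk_S: "(u, k) \<in> S"
        using Pd_mem good unfolding S_def spolynomials_def good_def by blast
      define C where "C = {(u, k). k \<in> G \<and> u + LM (poly_at st k) = t \<and> good st G u k}"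
      text \<open>Of any two elements of \<open>C\<close>, the one of larger signature lies in \<open>S\<close>, so at most one
        element of \<open>C\<close> is missing from \<open>S\<close>.\<close>
      have C_S: "y \<in> S" if xy: "x \<in> C" "y \<in> C" "x \<noteq> y" "x \<notin> S" for x y
      proof -
        obtain w g w' g' where x: "x = (w, g)" and y: "y = (w', g')" by (metis prod.exhaust)
        have g: "g \<in> G" "w + LM (poly_at st g) = t" "good st G w g"
          "g' \<in> G" "w' + LM (poly_at st g') = t" "good st G w' g'"
          using xy by (auto simp: C_def x y)
        have ne: "g \<noteq> g'" using g xy(3) by (auto simp: x y)
        have "sig_mult w (sig_at st g) \<noteq> sig_mult w' (sig_at st g')"
          using not_rewritable_unique[OF wf, of g g' w w'] g ne G_sub by (auto simp: good_def)
        then consider "sig_less (sig_mult w (sig_at st g)) (sig_mult w' (sig_at st g'))"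
          | "sig_less (sig_mult w' (sig_at st g')) (sig_mult w (sig_at st g))"
          using sig_less_linear by blast
        then show ?thesis
        proof cases
          case 1
          have "(t, w', g', w, g) \<in> P"
            using g ne 1 deg by (intro good_pair_mem[OF wf G_sub ok]) (auto simp: d)
          then show ?thesis
            using g unfolding S_def spolynomials_def Pd y good_def
            by (auto simp: pair_deg_def d)
        next
          case 2
          have "(t, w, g, w', g') \<in> P"
            using g ne 2 deg by (intro good_pair_mem[OF wf G_sub ok]) (auto simp: d)
          then have "(w, g) \<in> S"
            using g unfolding S_def spolynomials_def Pd good_def
            by (auto simp: pair_deg_def d)
          with xy(4) show ?thesis by (simp add: x)
        qed
      qed
      obtain x where "C \<subseteq> insert x (set F0)"
      proof (cases "C \<subseteq> S")
        case False
        then obtain x where "x \<in> C" "x \<notin> S" by blast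
        then show thesis using C_S F0(1) by (intro that[of x]) blast
      qed (use F0(1) that in blast)
      \<comment> \<open>The row \<open>(u, k)\<close> brings \<open>t\<close> into the initial set
        of monomials, so the loop is certain to treat \<open>t\<close>.\<close>
      moreover have "t \<in> (\<Union>(u, k)\<in>S. Poly_Mapping.keys (mmult u (poly_at st k)))"
      proof -
        have nz: "poly_at st k \<noteq> 0" using kl(1) by (simp add: G live_def)
        then have "mmult u (poly_at st k) \<noteq> 0" by (simp add: mmult_def single_times_eq_0_iff)
        then have "t \<in> Poly_Mapping.keys (mmult u (poly_at st k))"
          using LM_in_keys[of "mmult u (poly_at st k)"] nz uv(1) by (simp add: LM_mmult)
        then show ?thesis using uk_S by blast
      qed
      ultimately have "C \<subseteq> set F"
        unfolding C_def set_F using loop by (intro symbolic_loop_complete[where x = x]) auto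
      moreover have "(u, k) \<in> C" "(v, l) \<in> C" using kl uv good by (auto simp: C_def)
      ultimately obtain a b where ab: "a < length F" "F ! a = (v, l)" "b < length F" "F ! b = (u, k)"
        by (metis in_set_conv_nth subsetD)
      \<comment> \<open>Rows are sorted by signature, so \<open>(v, l)\<close> stands above
        \<open>(u, k)\<close>.\<close>
      have "a < b"
      proof (rule ccontr)
        assume "\<not> a < b"
        moreover have "a \<noteq> b" using ab kl(3) by auto
        ultimately have "b < a" by simp
        then have "sig_less (sig_mult u (sig_at st k)) (sig_mult v (sig_at st l))"
          using less ab unfolding sorted_wrt_iff_nth_less by fastforce
        then show False using less' sig_less_trans sig_less_irrefl by blast
      qed
      \<comment> \<open>The row of \<open>(u, k)\<close> no longer contains \<open>t\<close>, so its
        result is labelled anew and the new rule rejects \<open>(u, k)\<close>, against its goodness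
        in \<open>st'\<close>.\<close>
      have "Poly_Mapping.lookup (gaussian_elimination st F T ! b) t = 0"
        using ge(3)[OF _ _ \<open>a < b\<close> ab(3)] ab(2) kl(2) uv(2) by (simp add: G live_def)
      then have "\<not> (gaussian_elimination st F T ! b \<noteq> 0 \<and> LM (gaussian_elimination st F T ! b) = t)"
        using LM_in_keys by (auto simp: in_keys_iff)
      moreover have "((u, k), gaussian_elimination st F T ! b)
          \<in> set (zip F (gaussian_elimination st F T))"
        unfolding in_set_zip using ab ge(1) by (intro exI[of _ b]) simp
      ultimately have "rewritable st' u k" using rew' uv(1) by blast
      then show False using good'(1) by (simp add: good_def)
    qed
    then show "(mlcm (LM (poly_at st' k)) (LM (poly_at st' l)),
        mlcm (LM (poly_at st' k)) (LM (poly_at st' l)) - LM (poly_at st' k), k,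
        mlcm (LM (poly_at st' k)) (LM (poly_at st' l)) - LM (poly_at st' l), l) \<in> P - Pd"
      using mem unfolding same t_def[symmetric] u_def[symmetric] v_def[symmetric] by blast
  qed
qed


section \<open>The main algorithm\<close>

text \<open>Finiteness of \<open>P\<close> makes the degree \<open>d\<close> in the main loop a true
  minimum.\<close>

definition main_inv ::
  "('x, 'a::field) mpoly list \<Rightarrow> ('x, 'a) f45_state \<Rightarrow> nat set \<Rightarrow> 'x critpair set \<Rightarrow> bool"
  where "main_inv fs st G P \<longleftrightarrow> wf_state fs st \<and> G = live st \<and> finite P \<and>
    positions_in P G \<and> pairs_ok st G P"

lemma update_positions:
  "update st G k l = Some (t, u, k', v, l') \<Longrightarrow> {k', l'} = {k, l}"
  by (auto simp: update_def Let_def split: if_splits)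

text \<open>Goodness occurs in \<open>pairs_ok\<close> only as a premise, and extending the state
  can only destroy it.\<close>

lemma pairs_ok_extends:
  assumes "pairs_ok st G P" "extends st st'" "G \<subseteq> {..<length (labelled st)}"
  shows "pairs_ok st' G P"
  unfolding pairs_ok_def Let_def
proof (intro ballI impI)
  fix k l assume kl: "k \<in> G" "l \<in> G" "k \<noteq> l"
  have same: "poly_at st' k = poly_at st k" "poly_at st' l = poly_at st l"
    "sig_at st' k = sig_at st k" "sig_at st' l = sig_at st l"
    using kl assms(3) extends_poly_at[OF assms(2)] extends_sig_at[OF assms(2)] by auto
  have anti: "good st G u j" if "good st' G u j" "j \<in> G" for u j
    using that(1) assms(2) by (rule good_antimono) (use that(2) assms(3) in auto)
  assume "good st' G (mlcm (LM (poly_at st' k)) (LM (poly_at st' l)) - LM (poly_at st' k)) k"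
      "good st' G (mlcm (LM (poly_at st' k)) (LM (poly_at st' l)) - LM (poly_at st' l)) l"
    and "sig_less
      (sig_mult (mlcm (LM (poly_at st' k)) (LM (poly_at st' l)) - LM (poly_at st' l)) (sig_at st' l))
      (sig_mult (mlcm (LM (poly_at st' k)) (LM (poly_at st' l)) - LM (poly_at st' k)) (sig_at st' k))"
  then show "(mlcm (LM (poly_at st' k)) (LM (poly_at st' l)),
      mlcm (LM (poly_at st' k)) (LM (poly_at st' l)) - LM (poly_at st' k), k,
      mlcm (LM (poly_at st' k)) (LM (poly_at st' l)) - LM (poly_at st' l), l) \<in> P"
    unfolding same using anti kl by (intro pairs_okD[OF assms(1)]) auto
qed

lemma fold_enter:
  fixes st :: "('x, 'a::zero) f45_state"
  assumes "(G', P') = fold (enter st) ks (G, P)"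
    and "pairs_ok st G P" "finite P" "positions_in P G"
    and "G \<union> set ks \<subseteq> {..<length (labelled st)}"
  shows "G' = G \<union> set ks \<and> pairs_ok st G' P' \<and> finite P' \<and>
    positions_in P' G'"
  using assms
proof (induction ks arbitrary: G P)
  case (Cons i ks)
  define G1 where "G1 = insert i G"
  define P1 where "P1 = P \<union> {p. \<exists>j\<in>G. update st G i j = Some p}"
  have enter: "enter st i (G, P) = (G1, P1)" by (simp add: enter_def G1_def P1_def)
  have "finite G" using Cons.prems(5) by (auto intro: finite_subset)
  then have "finite ((\<lambda>j. the (update st G i j)) ` G)" by simp
  moreover have "{p. \<exists>j\<in>G. update st G i j = Some p} \<subseteq> (\<lambda>j. the (update st G i j)) ` G" by force
  ultimately have "finite P1"
    using Cons.prems(3) by (simp add: P1_def finite_subset)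
  moreover have "pairs_ok st G1 P1"
    using pairs_ok_enter[OF Cons.prems(2), of i] Cons.prems(5) by (simp add: enter)
  moreover have "positions_in P1 G1"
    unfolding positions_in_def
  proof (intro allI impI)
    fix t u k v l assume "(t, u, k, v, l) \<in> P1"
    then consider "(t, u, k, v, l) \<in> P" | j where "j \<in> G" "update st G i j = Some (t, u, k, v, l)"
      by (auto simp: P1_def)
    then show "k \<in> G1 \<and> l \<in> G1"
    proof cases
      case 1
      then show ?thesis using Cons.prems(4) by (auto simp: G1_def positions_in_def)
    next
      case 2
      then show ?thesis using update_positions[OF 2(2)] by (auto simp: G1_def doubleton_eq_iff)
    qed
  qed
  moreover have "G1 \<union> set ks \<subseteq> {..<length (labelled st)}" using Cons.prems(5) by (auto simp: G1_def)
  moreover have "(G', P') = fold (enter st) ks (G1, P1)" using Cons.prems(1) by (simp add: enter)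
  ultimately show ?case
    using Cons.IH[of G1 P1] by (auto simp: G1_def)
qed simp

text \<open>\<open>extends\<close> is recorded because the signatures \<open>(0, i)\<close> of the
  inputs must still be present at the end for \<open>rewriter_exists\<close>.\<close>

lemma main_loop_inv:
  assumes "main_loop st G P B" "main_inv fs st G P"
  shows "\<exists>st' G'. main_inv fs st' G' {} \<and> extends st st' \<and> B = poly_at st' ` G'"
  using assms
proof (induction rule: main_loop.induct)
  case (finish st G)
  then show ?case using extends_refl by blast
next
  case (step P d Pd S st G st' Fplus ks G' P' B)
  have inv: "wf_state fs st" "G = live st" "pairs_ok st G P" "finite P"
    and pos: "positions_in P G"
    using step.prems unfolding main_inv_def by blast+
  have deg: "d \<le> pair_deg p" if "p \<in> P" for p
    using that inv(4) by (simp add: step.hyps(2))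
  note red = reduction_correct[OF inv(1-3) pos deg step.hyps(3) step.hyps(5)[unfolded step.hyps(4)]]
  have "G' = G \<union> set ks \<and> pairs_ok st' G' P' \<and> finite P' \<and>
      positions_in P' G'"
    using step.hyps(8) red(4)
  proof (rule fold_enter)
    show "G \<union> set ks \<subseteq> {..<length (labelled st')}"
      using red(3) by (auto simp: step.hyps(6) live_def)
  qed (use inv(4) pos in \<open>auto simp: positions_in_def\<close>)
  then have "main_inv fs st' G' P'"
    using red(1,3) step.hyps(6) unfolding main_inv_def by auto
  then obtain st'' G'' where "main_inv fs st'' G'' {}" "extends st' st''" "B = poly_at st'' ` G''"
    using step.IH by blast
  then show ?case using extends_trans[OF red(2)] by blast
qed

lemma wf_state_empty: "wf_state fs \<lparr>labelled = [], rules = (\<lambda>_. [])\<rparr>"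
  by (simp add: wf_state_def)

lemma initialise_inv:
  fixes fs :: "('x, 'a::field) mpoly list"
  assumes "0 \<notin> set fs" "initialise fs = (st, G, P)"
  shows "main_inv fs st G P \<and> length (labelled st) = length fs \<and>
    (\<forall>i<length fs. sig_at st i = (0, i))"
proof -
  let ?st0 = "\<lparr>labelled = [], rules = (\<lambda>_. [])\<rparr> :: ('x, 'a) f45_state"
  \<comment> \<open>Stated for the first \<open>n\<close> inputs, so that the induction enters one
    input at a time; \<open>fs ! i\<close> gets position \<open>i\<close>.\<close>
  have "main_inv fs st G P \<and> length (labelled st) = n \<and> (\<forall>i<n. sig_at st i = (0, i))"
    if "n \<le> length fs" "fold add_input (zip [0..<n] (take n fs)) (?st0, {}, {}) = (st, G, P)"
    for n st G P
    using that
  proof (induction n arbitrary: st G P)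
    case 0
    then have "st = ?st0" "G = {}" "P = {}" by auto
    then show ?case
      by (simp add: main_inv_def wf_state_empty live_def pairs_ok_def positions_in_def)
  next
    case (Suc n)
    obtain st1 G1 P1 where
      1: "fold add_input (zip [0..<n] (take n fs)) (?st0, {}, {}) = (st1, G1, P1)"
      by (metis prod.exhaust)
    have inv: "main_inv fs st1 G1 P1" and len: "length (labelled st1) = n"
      and sig: "\<And>i. i < n \<Longrightarrow> sig_at st1 i = (0, i)"
      using Suc.IH[OF _ 1] Suc.prems(1) by auto
    define p where "p = Poly_Mapping.single 0 (inverse (LC (fs ! n))) * fs ! n"
    have nz: "fs ! n \<noteq> 0" using assms(1) Suc.prems(1) by (metis Suc_le_lessD nth_mem)
    then have LC: "LC (fs ! n) \<noteq> 0" using LM_in_keys by (simp add: LC_def in_keys_iff)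
    then have p: "p \<noteq> 0" using nz by (simp add: p_def single_times_eq_0_iff)
    have has: "has_sig fs p (0, n)"
      unfolding has_sig_def p_def fst_conv snd_conv using LC Suc.prems(1)
      by (intro conjI exI[of _ "inverse (LC (fs ! n))"] exI[of _ 0]) (simp_all add: lower.zero)
    have wf1: "wf_state fs st1" and G1: "G1 = live st1" and ok1: "pairs_ok st1 G1 P1"
      and fin1: "finite P1" and pos1: "positions_in P1 G1"
      using inv by (auto simp: main_inv_def)
    have zip: "zip [0..<Suc n] (take (Suc n) fs) = zip [0..<n] (take n fs) @ [(n, fs ! n)]"
      using Suc.prems(1) by (simp add: take_Suc_conv_app_nth zip_append)
    have "add_input (n, fs ! n) (st1, G1, P1) = (st, G, P)"
      using Suc.prems(2) unfolding zip fold_append comp_apply 1 by simp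
    then have st: "st = append_labelled (0, n) p st1" and GP: "(G, P) = enter st n (G1, P1)"
      by (auto simp: add_input_def p_def Let_def)
    have ext: "extends st1 st" and wf: "wf_state fs st"
      unfolding st using wf1 has
      by (rule extends_append_labelled, rule wf_state_append_labelled)
    have "pairs_ok st G1 P1"
      using ok1 ext by (rule pairs_ok_extends) (auto simp: G1 live_def)
    then have "G = G1 \<union> set [n] \<and> pairs_ok st G P \<and> finite P \<and>
        positions_in P G"
      using fin1 pos1 len GP by (intro fold_enter[of G P st "[n]" G1 P1]) (auto simp: G1 live_def st)
    moreover have "live st = insert n G1"
    proof -
      have "poly_at st n = p" using poly_at_append_labelled(1)[of "(0, n)" p st1] by (simp add: st len)
      moreover have "poly_at st k = poly_at st1 k" if "k < n" for k
        using that by (simp add: st len)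
      ultimately show ?thesis using p unfolding live_def G1 by (auto simp: st len less_Suc_eq)
    qed
    ultimately have "main_inv fs st G P" using wf unfolding main_inv_def by auto
    moreover have "sig_at st i = (0, i)" if "i < Suc n" for i
      using that sig[of i] sig_at_append_labelled(1)[of "(0, n)" p st1]
      by (cases "i = n") (simp_all add: st len)
    ultimately show ?case by (simp add: st len)
  qed
  from this[of "length fs" st G P] show ?thesis using assms(2) by (simp add: initialise_def)
qed


section \<open>Correctness\<close>

text \<open>This is the regular top-reducibility of signature-based methods; a reducer of signature
  \<sigma> itself does not count.\<close>

definition sig_reducible ::
  "('x, 'a::zero) f45_state \<Rightarrow> nat set \<Rightarrow> 'x monomial \<Rightarrow> 'x signature \<Rightarrow> bool"
  where "sig_reducible st G t \<sigma> \<longleftrightarrow>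
    (\<exists>w g. g \<in> G \<and> w + LM (poly_at st g) = t \<and> sig_less (sig_mult w (sig_at st g)) \<sigma>)"

lemma sig_reducible_mono: "sig_reducible st G t \<tau> \<Longrightarrow> sig_less \<tau> \<sigma> \<Longrightarrow> sig_reducible st G t \<sigma>"
  unfolding sig_reducible_def by (blast intro: sig_less_trans)

text \<open>Let \<open>q\<close> be the multiple of signature \<sigma> given by the rewriter. A
  suitable scalar multiple \<open>r\<close> of \<open>q\<close> puts \<open>p - r\<close> into
  \<open>lower fs \<sigma>\<close>, where \<open>low\<close> applies. If the F5 criterion rejects
  \<sigma>, or if \<open>q\<close> is 0, then \<open>p\<close> itself lies there.\<close>

lemma has_sig_reducible:
  fixes st :: "('x, 'a::field) f45_state"
  assumes wf: "wf_state fs st" and G: "G = live st"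
    and init: "\<And>i. i < length fs \<Longrightarrow> \<exists>k<length (labelled st). sig_at st k = (0, i)"
    and low: "\<And>p. p \<in> lower fs \<sigma> \<Longrightarrow> p \<noteq> 0 \<Longrightarrow> sig_reducible st G (LM p) \<sigma>"
    and irred: "\<And>u k. k \<in> G \<Longrightarrow> good st G u k \<Longrightarrow> sig_mult u (sig_at st k) = \<sigma> \<Longrightarrow>
      \<not> sig_reducible st G (u + LM (poly_at st k)) \<sigma>"
    and p: "has_sig fs p \<sigma>" "p \<noteq> 0"
  shows "sig_reducible st G (LM p) \<sigma> \<or>
    (\<exists>u k. k \<in> G \<and> good st G u k \<and> sig_mult u (sig_at st k) = \<sigma> \<and> u + LM (poly_at st k) = LM p)"
proof -
  obtain t i where \<sigma>: "\<sigma> = (t, i)" by (cases \<sigma>)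
  have "i < length fs" using p(1) by (simp add: has_sig_def \<sigma>)
  then obtain k0 where "k0 < length (labelled st)" "sig_at st k0 = (0, i)" using init by blast
  with wf obtain u k where k: "k < length (labelled st)"
    and sig: "sig_mult u (sig_at st k) = (t, i)" and nrew: "\<not> rewritable st u k"
    by (rule rewriter_exists)
  define q where "q = mmult u (poly_at st k)"
  have q: "has_sig fs q \<sigma>"
    unfolding q_def \<sigma> sig[symmetric] using wf k by (intro has_sig_mmult wf_state_has_sig)
  obtain c where c: "c \<noteq> 0" "p - Poly_Mapping.single 0 c * q \<in> lower fs \<sigma>"
    using p(1) q by (rule has_sig_cancel)
  show ?thesis
  proof (cases "top_reducible st t {g \<in> G. idx_at st g < i}")
    case True
    then obtain g where g: "g \<in> G" "snd (sig_at st g) < i" "mdvd (LM (poly_at st g)) t"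
      by (auto simp: top_reducible_def idx_at_def)
    then have "has_sig fs (poly_at st g) (sig_at st g)" "poly_at st g \<noteq> 0"
      using wf by (auto simp: G live_def wf_state_has_sig)
    then have "p \<in> lower fs \<sigma>"
      unfolding \<sigma> using g p(1)[unfolded \<sigma>] by (intro has_sig_top_reducible)
    then show ?thesis using low p(2) by blast
  next
    case False
    have good: "good st G u k"
      using False nrew sig by (auto simp: good_def idx_at_def sig_mult_def)
    show ?thesis
    proof (cases "poly_at st k = 0")
      case True
      then have "p \<in> lower fs \<sigma>" using c(2) by (simp add: q_def mmult_def)
      then show ?thesis using low p(2) by blast
    next
      case nz: False
      then have kG: "k \<in> G" using k by (simp add: G live_def)
      define r where "r = Poly_Mapping.single 0 c * q"
      have "q \<noteq> 0" using nz by (simp add: q_def mmult_def single_times_eq_0_iff)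
      then have r: "r \<noteq> 0" "LM r = u + LM (poly_at st k)"
        using c(1) nz
        by (simp_all add: r_def single_times_eq_0_iff LM_single_times) (simp add: q_def LM_mmult)
      have low_r: "p - r \<in> lower fs \<sigma>" using c(2) by (simp add: r_def)
      \<comment> \<open>If the leading monomials differ, the larger one is that of
        \<open>p - r\<close>. If it belongs to \<open>p\<close>, \<open>low\<close> gives the
        reducer; if it belongs to \<open>r\<close>, \<open>low\<close> contradicts
        \<open>irred\<close>.\<close>
      consider "LM p = LM r" | "LM r \<prec> LM p" | "LM p \<prec> LM r"
        using mo.less_linear by blast
      then show ?thesis
      proof cases
        case 1
        then show ?thesis using kG good sig r(2) \<sigma> by auto
      next
        case 2
        then show ?thesis using low[OF low_r] LM_minus_left[OF p(2) 2] by simp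
      next
        case 3
        then have "sig_reducible st G (LM r) \<sigma>"
          using low[OF low_r] LM_minus_right[OF r(1)] by simp
        then show ?thesis using irred[OF kG good] sig r(2) by (simp add: \<sigma>)
      qed
    qed
  qed
qed

text \<open>The two claims need each other: together at \<tau> they give
  \<open>has_sig_reducible\<close> at \<tau>, and from this, for all \<tau> below \<sigma>, both are
  derived at \<sigma>. The emptiness of the set of pairs enters in the second.\<close>

lemma lower_sig_reducible:
  fixes st :: "('x, 'a::field) f45_state"
  assumes inv: "main_inv fs st G {}"
    and init: "\<And>i. i < length fs \<Longrightarrow> \<exists>k<length (labelled st). sig_at st k = (0, i)"
  shows "(\<forall>p\<in>lower fs \<sigma>. p \<noteq> 0 \<longrightarrow> sig_reducible st G (LM p) \<sigma>) \<and>
    (\<forall>u k. k \<in> G \<longrightarrow> good st G u k \<longrightarrow> sig_mult u (sig_at st k) = \<sigma> \<longrightarrow>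
      \<not> sig_reducible st G (u + LM (poly_at st k)) \<sigma>)"
proof (induction \<sigma> rule: wfp_induct_rule[OF wfp_sig_less])
  case (1 \<sigma>)
  have wf: "wf_state fs st" and G: "G = live st" and ok: "pairs_ok st G {}"
    using inv by (auto simp: main_inv_def)
  have G_sub: "G \<subseteq> {..<length (labelled st)}" by (auto simp: G live_def)
  have step: "sig_reducible st G (LM p) \<tau> \<or>
      (\<exists>u k. k \<in> G \<and> good st G u k \<and> sig_mult u (sig_at st k) = \<tau> \<and> u + LM (poly_at st k) = LM p)"
    if "sig_less \<tau> \<sigma>" "has_sig fs p \<tau>" "p \<noteq> 0" for p \<tau>
    using 1[OF that(1)] by (intro has_sig_reducible[OF wf G init _ _ that(2,3)]) auto
  have "sig_reducible st G (LM p) \<sigma>" if p: "p \<in> lower fs \<sigma>" "p \<noteq> 0" for p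
  proof -
    obtain \<tau> where \<tau>: "sig_less \<tau> \<sigma>" "p \<in> lower fs \<tau> \<or> has_sig fs p \<tau>"
      using lower_signature[OF p(1)] p(2) by blast
    from \<tau>(2) show ?thesis
    proof
      assume "p \<in> lower fs \<tau>"
      then show ?thesis using 1[OF \<tau>(1)] p(2) \<tau>(1) sig_reducible_mono by blast
    next
      assume "has_sig fs p \<tau>"
      from step[OF \<tau>(1) this p(2)] show ?thesis
        using \<tau>(1) sig_reducible_mono unfolding sig_reducible_def by blast
    qed
  qed
  moreover have False
    if k: "k \<in> G" "good st G u k" "sig_mult u (sig_at st k) = \<sigma>"
      and red: "sig_reducible st G (u + LM (poly_at st k)) \<sigma>" for u k
  proof -
    \<comment> \<open>Inner induction on the signature \<tau> of the supposed reducer: either there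
      is a reducer of still smaller signature, or a good multiple of signature \<tau> has the same
      leading monomial.\<close>
    have no: False if "sig_less \<tau> \<sigma>" "g \<in> G" "w + LM (poly_at st g) = u + LM (poly_at st k)"
      "sig_mult w (sig_at st g) = \<tau>" for \<tau> w g
      using that
    proof (induction \<tau> arbitrary: w g rule: wfp_induct_rule[OF wfp_sig_less])
      case (1 \<tau>)
      define p where "p = mmult w (poly_at st g)"
      have nz: "poly_at st g \<noteq> 0" and g: "g < length (labelled st)"
        using 1(3) by (auto simp: G live_def)
      have "has_sig fs p \<tau>"
        unfolding p_def 1(5)[symmetric] using wf g by (intro has_sig_mmult wf_state_has_sig)
      moreover have "p \<noteq> 0" "LM p = u + LM (poly_at st k)"
        using nz 1(4) by (simp_all add: p_def LM_mmult) (simp add: mmult_def single_times_eq_0_iff)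
      ultimately consider "sig_reducible st G (u + LM (poly_at st k)) \<tau>"
        | v l where "l \<in> G" "good st G v l" "sig_mult v (sig_at st l) = \<tau>"
          "v + LM (poly_at st l) = u + LM (poly_at st k)"
        using step[OF 1(2)] by fastforce
      then show False
      proof cases
        case a: 1
        then obtain v l where "l \<in> G" "v + LM (poly_at st l) = u + LM (poly_at st k)"
          "sig_less (sig_mult v (sig_at st l)) \<tau>"
          unfolding sig_reducible_def by blast
        then show False using 1(1) 1(2) sig_less_trans by blast
      next
        case (2 v l)
        have "k \<noteq> l"
        proof
          assume "k = l"
          then have "\<tau> = \<sigma>" using 2 k(3) by simp
          then show False using 1(2) by simp
        qed
        \<comment> \<open>With no pairs left, the degree condition of \<open>good_pair_mem\<close>
          is vacuous, so two good multiples of distinct positions cannot share a leading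
          monomial.\<close>
        then have "(u + LM (poly_at st k), u, k, v, l) \<in> {}"
          using 2 k 1(2) by (intro good_pair_mem[OF wf G_sub ok]) auto
        then show False by simp
      qed
    qed
    from red show False unfolding sig_reducible_def using no by blast
  qed
  ultimately show ?case by blast
qed

lemma main_inv_groebner_basis:
  fixes st :: "('x, 'a::field) f45_state"
  assumes "main_inv fs st G {}"
    and "\<And>i. i < length fs \<Longrightarrow> \<exists>k<length (labelled st). sig_at st k = (0, i)"
  shows "groebner_basis (poly_at st ` G) (ideal_gen (set fs))"
proof -
  let ?B = "poly_at st ` G" and ?I = "ideal_gen (set fs)"
  let ?X = "{Poly_Mapping.single (LM g) (1 :: 'a) | g. g \<in> ?B \<and> g \<noteq> 0}"
  let ?Y = "{Poly_Mapping.single (LM f) (1 :: 'a) | f. f \<in> ?I \<and> f \<noteq> 0}"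
  have wf: "wf_state fs st" and G: "G = live st" using assms(1) by (auto simp: main_inv_def)
  have sub: "?B \<subseteq> ?I"
  proof
    fix p assume "p \<in> ?B"
    then obtain k where "k < length (labelled st)" "p = poly_at st k" by (auto simp: G live_def)
    then have "has_sig fs p (sig_at st k)" using wf by (simp add: wf_state_has_sig)
    then have "p \<in> lower fs (0, length fs)"
      by (rule has_sig_lower) (use \<open>has_sig fs p (sig_at st k)\<close> in \<open>simp add: has_sig_def sig_less_def\<close>)
    then show "p \<in> ?I" by (simp add: ideal_gen_eq_lower)
  qed
  have "?Y \<subseteq> ideal_gen ?X"
  proof
    fix q assume "q \<in> ?Y"
    then obtain f where f: "f \<in> lower fs (0, length fs)" "f \<noteq> 0"
      and q: "q = Poly_Mapping.single (LM f) 1"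
      by (auto simp: ideal_gen_eq_lower)
    \<comment> \<open>The whole ideal lies below the signature \<open>(0, length fs)\<close>. Of the
      result only the divisibility of leading monomials is kept.\<close>
    then obtain w g where g: "g \<in> G" "w + LM (poly_at st g) = LM f"
      using lower_sig_reducible[OF assms, of "(0, length fs)"] unfolding sig_reducible_def by blast
    have "Poly_Mapping.single (LM (poly_at st g)) 1 \<in> ideal_gen ?X"
      unfolding ideal_gen_def using g(1)
      by (intro module.span_base[OF module_times]) (auto simp: G live_def)
    then have "Poly_Mapping.single w 1 * Poly_Mapping.single (LM (poly_at st g)) 1 \<in> ideal_gen ?X"
      unfolding ideal_gen_def by (rule module.span_scale[OF module_times])
    then show "q \<in> ideal_gen ?X" by (simp add: mult_single g(2) q)
  qed
  then have "ideal_gen ?Y \<subseteq> ideal_gen ?X"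
    unfolding ideal_gen_def
    by (rule module.span_minimal[OF module_times _ module.subspace_span[OF module_times]])
  moreover have "?X \<subseteq> ?Y" using sub by auto
  then have "ideal_gen ?X \<subseteq> ideal_gen ?Y"
    unfolding ideal_gen_def by (rule module.span_mono[OF module_times])
  ultimately have "ideal_gen ?X = ideal_gen ?Y" by (rule antisym[rotated])
  then show ?thesis using sub by (simp add: groebner_basis_def G live_def)
qed

text \<open>Signatures refer to the sorted list \<open>fs'\<close>, but the ideal depends only on
  its set of entries, which is that of \<open>fs\<close>.\<close>

lemma F45_groebner_basis:
  assumes "0 \<notin> set fs" "F45 fs B"
  shows "groebner_basis B (ideal_gen (set fs))"
proof -
  obtain fs' st G P where "mset fs' = mset fs" and init: "initialise fs' = (st, G, P)"
    and loop: "main_loop st G P B"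
    using assms(2) unfolding F45_def by blast
  then have set: "set fs' = set fs" by (metis set_mset_mset)
  have inv: "main_inv fs' st G P" "length (labelled st) = length fs'"
    "\<And>i. i < length fs' \<Longrightarrow> sig_at st i = (0, i)"
    using initialise_inv[OF _ init] assms(1) set by auto
  obtain st' G' where st': "main_inv fs' st' G' {}" "extends st st'" "B = poly_at st' ` G'"
    using main_loop_inv[OF loop inv(1)] by blast
  have "\<exists>k<length (labelled st'). sig_at st' k = (0, i)" if "i < length fs'" for i
    using that inv(2,3) extends_sig_at[OF st'(2), of i] extends_length[OF st'(2)]
    by (intro exI[of _ i]) simp
  then show ?thesis using main_inv_groebner_basis[OF st'(1)] st'(3) set by simp
qed

end

theorem theorem4p4:
  fixes le lt :: "'x::finite monomial \<Rightarrow> 'x monomial \<Rightarrow> bool"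
    and fs gs :: "('x, 'a::field) mpoly list"
  assumes "monomial_ordering le lt"
    and "\<And>f. f \<in> set fs \<Longrightarrow> f \<noteq> 0 \<and> homogeneous f"
    and "monomial_ordering.F45 le lt fs (set gs)"
    and "\<And>g. g \<in> set gs \<Longrightarrow> homogeneous g"
  shows "monomial_ordering.groebner_basis le (set gs) (ideal_gen (set fs))"
  using monomial_ordering.F45_groebner_basis[OF assms(1) _ assms(3)] assms(2) by blast

end
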